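(* Let $c=(c_1,c_2)$ be a constant in $\mathbb{C}^2$. Then any transcendental entire solution $f$ on $\mathbb{C}^2$ with finite order of the partial differential-difference equation $$\left(\frac{\partial f(z_1,z_2)}{\partial z_1}\right)^2+f^2(z_1+c_1,z_2+c_2)=1$$ is of the form $$f(z_1,z_2)=\frac{A}{2i}\left(\beta_1e^{\alpha\left(\frac{i}{\alpha}Az_1+Bz_2+h(z_2)\right)}-\beta_2e^{-\alpha\left(\frac{i}{\alpha}Az_1+Bz_2+h(z_2)\right)}\right),$$ where $A$, $B$, $\alpha\neq 0$, $\beta_1$, $\beta_2$ are complex constants with $A^2=1$ and $\beta_1\beta_2=1$, and $h$ is a polynomial in $z_2$ satisfying the relation $$h(z_2)-h(z_2+c_2)=\frac{i}{\alpha}Ac_1+Bc_2+\frac{1}{\alpha}\log A,$$ and $Ae^{iAc_1+\alpha Bc_2}=1$. In the special case whenever $c_2\neq0$, $h$ reduces to a constant and the form of the solution is $$f(z_1,z_2)=\frac{A}{2i}\left(\beta_1e^{\alpha\left(\frac{i}{\alpha}Az_1+Bz_2+C\right)}-\beta_2e^{-\alpha\left(\frac{i}{\alpha}Az_1+Bz_2+C\right)}\right)$$ with $C\in\mathbb{C}$ a constant.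
   Context: An entire function on $\mathbb{C}^2$ is transcendental if it is not a polynomial; it has finite order if $\limsup_{r\to\infty}\frac{\log^+T(r,f)}{\log r}<\infty$, where $T(r,f)$ is the Nevanlinna characteristic function on $\mathbb{C}^2$. Here $f^2(z_1+c_1,z_2+c_2)$ means $\left(f(z_1+c_1,z_2+c_2)\right)^2$. The symbol $\log A$ denotes a value of the complex logarithm, i.e. some complex number $w$ with $e^{w}=A$. *)

theory Defs
  imports "HOL-Analysis.Analysis" "HOL-Computational_Algebra.Polynomial"
begin

text \<open>
  Points of \<open>\<complex>\<^sup>2\<close> are pairs; the product norm is
  the Hermitian norm \<open>sqrt (|z1|\<^sup>2 + |z2|\<^sup>2)\<close>. An entire function
  has a complex-linear Frechet derivative at every point.
\<close>

definition entire_C2 :: "(complex \<times> complex \<Rightarrow> complex) \<Rightarrow> bool" where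
  "entire_C2 f \<longleftrightarrow>
     (\<forall>z. \<exists>a b. (f has_derivative (\<lambda>v. a * fst v + b * snd v)) (at z))"

definition polynomial_C2 :: "(complex \<times> complex \<Rightarrow> complex) \<Rightarrow> bool" where
  "polynomial_C2 f \<longleftrightarrow>
     (\<exists>(N::nat) (a :: nat \<Rightarrow> nat \<Rightarrow> complex).
        \<forall>z1 z2. f (z1, z2) = (\<Sum>i\<le>N. \<Sum>j\<le>N. a i j * z1 ^ i * z2 ^ j))"

definition transcendental_entire_C2 :: "(complex \<times> complex \<Rightarrow> complex) \<Rightarrow> bool" where
  "transcendental_entire_C2 f \<longleftrightarrow> entire_C2 f \<and> \<not> polynomial_C2 f"

definition partial_z1 :: "(complex \<times> complex \<Rightarrow> complex) \<Rightarrow> complex \<Rightarrow> complex \<Rightarrow> complex" where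
  "partial_z1 f z1 z2 = deriv (\<lambda>w. f (w, z2)) z1"

definition log_plus :: "real \<Rightarrow> real" where
  "log_plus x = ln (max 1 x)"

text \<open>
  The rotation-invariant probability measure on the unit sphere
  \<open>|z1|\<^sup>2 + |z2|\<^sup>2 = 1\<close>, that is, the restriction to that sphere of the form
  \<open>d\<^sup>c log |z|\<^sup>2 \<and> dd\<^sup>c log |z|\<^sup>2\<close>, normalised to total mass 1. It is obtained
  as the radial projection (\<^const>\<open>sgn\<close> is \<open>x / |x|\<close>) of the uniform
  distribution on the unit ball.
\<close>

definition sphere_measure_C2 :: "(complex \<times> complex) measure" where
  "sphere_measure_C2 = distr (uniform_measure lborel (ball 0 1)) borel sgn"

text \<open>
  The Nevanlinna characteristic is \<open>T(r,f) = m(r,f) + N(r,f)\<close>, where the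
  proximity function \<open>m(r,f)\<close> is the mean of \<open>log\<^sup>+ |f|\<close> over the sphere of
  radius \<open>r\<close> and \<open>N(r,f)\<close> counts poles. An entire function has no poles, so
  for the functions considered here \<open>T(r,f) = m(r,f)\<close>.
\<close>

definition nevanlinna_T :: "real \<Rightarrow> (complex \<times> complex \<Rightarrow> complex) \<Rightarrow> real" where
  "nevanlinna_T r f = (\<integral>x. log_plus (cmod (f (r *\<^sub>R x))) \<partial>sphere_measure_C2)"

definition finite_order_C2 :: "(complex \<times> complex \<Rightarrow> complex) \<Rightarrow> bool" where
  "finite_order_C2 f \<longleftrightarrow>
     Limsup at_top (\<lambda>r::real. ereal (log_plus (nevanlinna_T r f) / ln r)) < \<infinity>"

end

theory Submission
  imports Defs "HOL-Complex_Analysis.Complex_Analysis"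
begin

text \<open>
  Factoring the equation as \<open>(f\<^sub>z\<^sub>1 + i f(z + c)) (f\<^sub>z\<^sub>1 - i f(z + c)) = 1\<close> and taking a continuous logarithm of
  the first factor gives \<open>f = sin v\<close> and \<open>f\<^sub>z\<^sub>1 = cos v(z + c)\<close> with \<open>v\<close> holomorphic on complex lines. Since
  \<open>log\<^sup>+ |sin w| \<ge> |Im w| - log 4\<close>, finite order bounds the spherical means of \<open>|Im v|\<close> by a power of the
  radius; by orthogonality of the homogeneous parts of \<open>v\<close> on the sphere, only finitely many of them survive,
  so \<open>v\<close> has polynomial growth and is polynomial on every line \<open>z\<^sub>2 = const\<close>. On such a line
  \<open>v\<^sub>z\<^sub>1 cos v = cos v(z + c)\<close>, and the linear independence of exponentials of polynomials forces
  \<open>v\<^sub>z\<^sub>1 \<in> {0, 1, -1}\<close>. By continuity this value \<open>A\<close> does not depend on \<open>z\<^sub>2\<close>, and it is not \<open>0\<close> because \<open>f\<close> is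
  not constant. Hence \<open>v = A z\<^sub>1 + q(z\<^sub>2)\<close>, where \<open>q(z\<^sub>2 + c\<^sub>2) - q(z\<^sub>2)\<close> is constant; if \<open>c\<^sub>2 \<noteq> 0\<close> then \<open>q'\<close> is a
  periodic polynomial and \<open>q\<close> is affine.
\<close>

subsection \<open>Rotation invariance on the sphere\<close>

text \<open>By Fubini, integrate over \<open>x\<close> first: for fixed \<open>y\<close> the map is
  the translation by \<open>\<phi> y\<close>, which leaves Lebesgue measure unchanged.\<close>

lemma lborel_shear:
  fixes \<phi> :: "'b::euclidean_space \<Rightarrow> 'a::euclidean_space"
  assumes [measurable]: "\<phi> \<in> borel_measurable borel"
  shows "distr lborel borel (\<lambda>(x, y). (x + \<phi> y, y)) = lborel"
proof (rule measure_eqI)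
  fix X assume "X \<in> sets (distr lborel borel (\<lambda>(x, y). (x + \<phi> y, y)))"
  then have [measurable]: "X \<in> sets (borel :: ('a \<times> 'b) measure)" by simp
  have [measurable]: "(\<lambda>(x, y). (x + \<phi> y, y)) \<in> borel_measurable borel"
    unfolding borel_prod[symmetric] by measurable
  have X': "X \<in> sets (lborel \<Otimes>\<^sub>M lborel)"
    unfolding lborel_prod by simp
  have ind: "indicator X \<in> borel_measurable (lborel \<Otimes>\<^sub>M lborel)"
    using X' by measurable
  have "emeasure (distr lborel borel (\<lambda>(x, y). (x + \<phi> y, y))) X
      = (\<integral>\<^sup>+ p. indicator X p \<partial>distr lborel borel (\<lambda>(x, y). (x + \<phi> y, y)))"
    by simp
  also have "\<dots> = (\<integral>\<^sup>+ p. indicator X (case p of (x, y) \<Rightarrow> (x + \<phi> y, y)) \<partial>lborel)"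
    by (subst nn_integral_distr) auto
  also have "\<dots> = (\<integral>\<^sup>+ p. indicator X (case p of (x, y) \<Rightarrow> (x + \<phi> y, y)) \<partial>(lborel \<Otimes>\<^sub>M lborel))"
    by (simp add: lborel_prod)
  also have "\<dots> = (\<integral>\<^sup>+ y. \<integral>\<^sup>+ x. indicator X (x + \<phi> y, y) \<partial>lborel \<partial>lborel)"
  proof -
    have "(\<lambda>p. indicator X (case p of (x, y) \<Rightarrow> (x + \<phi> y, y)) :: ennreal) \<in> borel_measurable borel"
      by measurable
    then have m: "(\<lambda>p. indicator X (case p of (x, y) \<Rightarrow> (x + \<phi> y, y)) :: ennreal)
      \<in> borel_measurable (lborel \<Otimes>\<^sub>M lborel)"
      by (simp add: lborel_prod)
    show ?thesis
      using lborel_pair.nn_integral_snd[OF m] by simp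
  qed
  also have "\<dots> = (\<integral>\<^sup>+ y. \<integral>\<^sup>+ x. indicator X (x, y) \<partial>lborel \<partial>lborel)"
  proof (rule nn_integral_cong)
    fix y :: 'b
    have mm: "(\<lambda>x. indicator X (x, y) :: ennreal) \<in> borel_measurable borel"
    proof -
      have "(\<lambda>x. (x, y)) \<in> borel_measurable borel" by (intro borel_measurable_continuous_onI continuous_intros)
      then show ?thesis by measurable
    qed
    have "(\<integral>\<^sup>+ x. indicator X (x, y) \<partial>lborel) = (\<integral>\<^sup>+ x. indicator X (x, y) \<partial>distr lborel borel (\<lambda>x. \<phi> y + x))"
      using lborel_affine[of 1 "\<phi> y"] by (simp add: density_1)
    also have "\<dots> = (\<integral>\<^sup>+ x. indicator X (x + \<phi> y, y) \<partial>lborel)"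
      using mm by (subst nn_integral_distr) (auto simp: add.commute)
    finally show "(\<integral>\<^sup>+ x. indicator X (x + \<phi> y, y) \<partial>lborel) = (\<integral>\<^sup>+ x. indicator X (x, y) \<partial>lborel)" by simp
  qed
  also have "\<dots> = emeasure (lborel \<Otimes>\<^sub>M lborel) X"
    using lborel_pair.nn_integral_snd[OF ind] X' by simp
  finally show "emeasure (distr lborel borel (\<lambda>(x, y). (x + \<phi> y, y))) X = emeasure lborel X"
    by (simp add: lborel_prod)
qed simp

lemma lborel_prod_swap:
  "distr lborel borel (\<lambda>(x, y). (y, x)) = (lborel :: ('a::euclidean_space \<times> 'b::euclidean_space) measure)"
proof -
  have "distr lborel borel (\<lambda>(x, y). (y, x)) = distr (lborel \<Otimes>\<^sub>M lborel) (lborel \<Otimes>\<^sub>M lborel) (\<lambda>(x :: 'b, y :: 'a). (y, x))"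
    by (rule distr_cong) (auto simp only: lborel_prod sets_lborel)
  also have "\<dots> = lborel \<Otimes>\<^sub>M lborel"
    by (rule lborel_pair.distr_pair_swap[symmetric])
  finally show ?thesis by (simp only: lborel_prod)
qed

text \<open>Lebesgue measure is determined by the volumes of boxes, and a complex box pulls back to
  a real box with the same sides. This carries the shear argument over to
  \<open>complex\<close>.\<close>

lemma lborel_complex:
  "distr (lborel :: (real \<times> real) measure) borel (\<lambda>(x, y). Complex x y) = lborel"
proof (rule lborel_eqI[symmetric])
  have [measurable]: "(\<lambda>(x, y). Complex x y) \<in> borel_measurable borel"
    by (intro borel_measurable_continuous_onI)
       (auto simp: case_prod_beta' complex_eq intro!: continuous_intros)
  fix l u :: complex
  assume le: "\<And>b. b \<in> Basis \<Longrightarrow> l \<bullet> b \<le> u \<bullet> b"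
  have pre: "(\<lambda>(x, y). Complex x y) -` box l u = box (Re l, Im l) (Re u, Im u)"
    by (auto simp: box_def Basis_complex_def Basis_prod_def inner_complex_def)
  show "emeasure (distr lborel borel (\<lambda>(x, y). Complex x y)) (box l u) = (\<Prod>b\<in>Basis. (u - l) \<bullet> b)"
    using le[of 1] le[of \<i>]
    by (simp add: emeasure_distr pre emeasure_lborel_box_eq)
      (auto simp: Basis_complex_def Basis_prod_def inner_complex_def)
qed simp

lemma lborel_complex_rotation:
  assumes "0 < \<theta>" "\<theta> < pi"
  shows "distr lborel borel (\<lambda>z. cis \<theta> * z) = lborel"
proof -
  \<comment> \<open>A plane rotation is a composition of three shears; this excludes \<open>\<theta> = \<pi>\<close>.\<close>
  define t where "t = tan (\<theta> / 2)"
  define S1 where "S1 = (\<lambda>(x, y). (x + - t * y, y :: real))"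
  define S2 where "S2 = (\<lambda>(x, y). (x, y + sin \<theta> * x :: real))"
  have c: "cos (\<theta> / 2) \<noteq> 0"
    using cos_gt_zero_pi[of "\<theta> / 2"] assms by auto
  \<comment> \<open>These two half-angle identities are what makes the product of the three shear
    matrices equal to the rotation matrix.\<close>
  have ct: "cos \<theta> = 1 - t * sin \<theta>" "t * (1 + cos \<theta>) = sin \<theta>"
  proof -
    have s: "sin \<theta> = 2 * sin (\<theta>/2) * cos (\<theta>/2)" "cos \<theta> = 2 * (cos (\<theta>/2))\<^sup>2 - 1"
      "(sin (\<theta>/2))\<^sup>2 + (cos (\<theta>/2))\<^sup>2 = 1"
      using sin_double[of "\<theta>/2"] cos_double_cos[of "\<theta>/2"] by auto
    have "t * sin \<theta> = 2 * (sin (\<theta>/2))\<^sup>2"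
      using c unfolding s(1) t_def tan_def by (simp add: power2_eq_square)
    with s(2) sin_squared_eq[of "\<theta>/2"] show "cos \<theta> = 1 - t * sin \<theta>" by simp
    show "t * (1 + cos \<theta>) = sin \<theta>"
      using c s unfolding t_def tan_def by (simp add: field_simps power2_eq_square)
  qed
  have m1[measurable]: "S1 \<in> borel_measurable borel" and m2[measurable]: "S2 \<in> borel_measurable borel"
    unfolding S1_def S2_def case_prod_beta'
    by (intro borel_measurable_continuous_onI continuous_intros)+
  have [measurable]: "(\<lambda>(x, y). Complex x y) \<in> borel_measurable borel"
    by (intro borel_measurable_continuous_onI)
       (auto simp: case_prod_beta' complex_eq intro!: continuous_intros)
  have sw[measurable]: "(\<lambda>(x, y). (y, x)) \<in> borel_measurable (borel :: (real \<times> real) measure)"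
    unfolding case_prod_beta' by (intro borel_measurable_continuous_onI continuous_intros)
  have d1: "distr lborel borel S1 = lborel"
    unfolding S1_def by (rule lborel_shear) simp
  \<comment> \<open>\<open>lborel_shear\<close> moves the first coordinate, so \<open>S2\<close> is
    treated as the conjugate of \<open>S2'\<close> by the coordinate swap.\<close>
  define S2' where "S2' = (\<lambda>(x, y). (x + sin \<theta> * y :: real, y))"
  have m3[measurable]: "S2' \<in> borel_measurable borel"
    unfolding S2'_def case_prod_beta' by (intro borel_measurable_continuous_onI continuous_intros)
  have d2': "distr lborel borel S2' = lborel"
    unfolding S2'_def by (rule lborel_shear) simp
  have d2: "distr lborel borel S2 = lborel"
  proof -
    have "S2 = (\<lambda>(x, y). (y, x)) \<circ> (S2' \<circ> (\<lambda>(x, y). (y, x)))"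
      by (auto simp: S2_def S2'_def)
    then have "distr lborel borel S2 =
      distr (distr (distr lborel borel (\<lambda>(x, y). (y, x))) borel S2') borel (\<lambda>(x, y). (y, x))"
      by (simp add: distr_distr)
    then show ?thesis by (simp add: lborel_prod_swap d2')
  qed
  have d: "distr lborel borel (S1 \<circ> (S2 \<circ> S1)) = lborel"
  proof -
    have "distr lborel borel (S1 \<circ> (S2 \<circ> S1)) = distr (distr (distr lborel borel S1) borel S2) borel S1"
      by (simp add: distr_distr)
    then show ?thesis by (simp add: d1 d2)
  qed
  have eq: "(\<lambda>z. cis \<theta> * z) \<circ> (\<lambda>(x, y). Complex x y) = (\<lambda>(x, y). Complex x y) \<circ> (S1 \<circ> (S2 \<circ> S1))"
  proof (rule ext, clarsimp simp: S1_def S2_def)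
    fix x y :: real
    have e2: "t * cos \<theta> = sin \<theta> - t" using ct(2) by (simp add: algebra_simps)
    have "cos \<theta> * x - sin \<theta> * y = x - t * y - t * (y + sin \<theta> * (x - t * y))"
    proof -
      have "t * (sin \<theta> * (x - t * y)) = (t * sin \<theta>) * (x - t * y)" by simp
      also have "t * sin \<theta> = 1 - cos \<theta>" using ct(1) by simp
      also have "(1 - cos \<theta>) * (x - t * y) = x - t * y - cos \<theta> * x + (t * cos \<theta>) * y" by (simp add: algebra_simps)
      finally show ?thesis unfolding e2 by (simp add: algebra_simps)
    qed
    moreover have "cos \<theta> * y + sin \<theta> * x = y + sin \<theta> * (x - t * y)"
      unfolding ct(1) by (simp add: algebra_simps)
    ultimately show "cis \<theta> * Complex x y = Complex (x - t * y - t * (y + sin \<theta> * (x - t * y))) (y + sin \<theta> * (x - t * y))"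
      by (simp add: complex_eq_iff)
  qed
  have "distr lborel borel (\<lambda>z. cis \<theta> * z) = distr (lborel :: (real \<times> real) measure) borel ((\<lambda>z. cis \<theta> * z) \<circ> (\<lambda>(x, y). Complex x y))"
    by (subst lborel_complex[symmetric]) (simp add: distr_distr)
  also have "\<dots> = distr (distr lborel borel (S1 \<circ> (S2 \<circ> S1))) borel (\<lambda>(x, y). Complex x y)"
    unfolding eq by (simp add: distr_distr)
  also have "\<dots> = lborel" by (simp add: d lborel_complex)
  finally show ?thesis .
qed

lemma lborel_C2_rotation:
  assumes "0 < \<theta>" "\<theta> < pi"
  shows "distr lborel borel (\<lambda>z :: complex \<times> complex. (cis \<theta> * fst z, cis \<theta> * snd z)) = lborel"
proof -
  have "lborel \<Otimes>\<^sub>M lborel = distr lborel borel (\<lambda>z. cis \<theta> * z) \<Otimes>\<^sub>M distr lborel borel (\<lambda>z. cis \<theta> * z)"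
    by (simp add: lborel_complex_rotation[OF assms])
  also have "\<dots> = distr (lborel \<Otimes>\<^sub>M lborel) (borel \<Otimes>\<^sub>M borel) (\<lambda>(x, y). (cis \<theta> * x, cis \<theta> * y))"
    using lborel_complex_rotation[OF assms] by (intro pair_measure_distr) (auto simp: lborel.sigma_finite_measure_axioms)
  finally show ?thesis by (simp add: lborel_prod borel_prod case_prod_beta')
qed

section \<open>Complex scaling and the sphere measure\<close>

text \<open>Unimodular scalars give the rotations of the sphere; general ones parametrise the
  complex lines through the origin.\<close>

definition cscale :: "complex \<Rightarrow> complex \<times> complex \<Rightarrow> complex \<times> complex" where
  "cscale \<mu> z = (\<mu> * fst z, \<mu> * snd z)"

lemma norm_cscale: "norm (cscale \<mu> z) = cmod \<mu> * norm z"
  by (simp add: cscale_def norm_prod_def norm_mult power_mult_distrib real_sqrt_mult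
      flip: distrib_left)

lemma cscale_of_real: "cscale (of_real r) z = r *\<^sub>R z"
  by (cases z) (simp add: cscale_def scaleR_conv_of_real)

lemma cscale_cscale: "cscale a (cscale b z) = cscale (a * b) z"
  by (simp add: cscale_def)

lemma cscale_scaleR: "cscale \<mu> (r *\<^sub>R z) = r *\<^sub>R cscale \<mu> z"
  by (simp add: cscale_def)

lemma continuous_on_cscale [continuous_intros]:
  assumes "continuous_on S f" "continuous_on S g"
  shows "continuous_on S (\<lambda>x. cscale (f x) (g x))"
  unfolding cscale_def using assms by (intro continuous_intros)

lemma cscale_measurable [measurable]: "cscale \<mu> \<in> borel_measurable borel"
  by (intro borel_measurable_continuous_onI continuous_intros)

lemma ball_C2_emeasure:
  "emeasure lborel (ball 0 1 :: (complex \<times> complex) set) \<noteq> 0"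
  "emeasure lborel (ball 0 1 :: (complex \<times> complex) set) \<noteq> \<infinity>"
proof -
  show "emeasure lborel (ball 0 1 :: (complex \<times> complex) set) \<noteq> 0"
    using content_ball_pos[of 1 "0 :: complex \<times> complex"]
    by (auto simp: measure_def)
  show "emeasure lborel (ball 0 1 :: (complex \<times> complex) set) \<noteq> \<infinity>"
    using emeasure_lborel_ball_finite[of "0 :: complex \<times> complex" 1] by simp
qed

lemma sets_sphere_measure_C2 [measurable_cong, simp]: "sets sphere_measure_C2 = sets borel"
  by (simp add: sphere_measure_C2_def)

lemma space_sphere_measure_C2 [simp]: "space sphere_measure_C2 = UNIV"
  by (simp add: sphere_measure_C2_def)

lemma emeasure_sphere_measure_C2_UNIV: "emeasure sphere_measure_C2 UNIV = 1"
  using ball_C2_emeasure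
  by (simp add: sphere_measure_C2_def emeasure_distr divide_eq_1_ennreal)

lemma finite_measure_sphere_measure_C2: "finite_measure sphere_measure_C2"
  by (rule finite_measureI) (simp add: emeasure_sphere_measure_C2_UNIV)

interpretation sphere_C2: finite_measure sphere_measure_C2
  by (rule finite_measure_sphere_measure_C2)

text \<open>Every value of \<open>sgn\<close> satisfies the bound, including
  \<open>sgn 0 = 0\<close>. It confines integrals to the compact unit ball, where continuous
  functions are bounded.\<close>

lemma AE_sphere_measure_C2: "AE x in sphere_measure_C2. norm x \<le> 1"
  unfolding sphere_measure_C2_def by (subst AE_distr_iff) (auto simp: norm_sgn)

lemma integrable_sphere_measure_C2:
  fixes g :: "complex \<times> complex \<Rightarrow> 'b::{banach, second_countable_topology}"
  assumes "continuous_on UNIV g"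
  shows "integrable sphere_measure_C2 g"
proof -
  have "compact (g ` cball 0 1)"
    by (intro compact_continuous_image continuous_on_subset[OF assms]) auto
  then obtain B where "\<And>x. norm x \<le> 1 \<Longrightarrow> norm (g x) \<le> B"
    by (force dest!: compact_imp_bounded simp: bounded_iff simp del: split_paired_All)
  moreover have "g \<in> borel_measurable sphere_measure_C2"
    using borel_measurable_continuous_onI[OF assms] by simp
  ultimately show ?thesis
    using AE_sphere_measure_C2 by (intro sphere_C2.integrable_const_bound[of _ B]) auto
qed

text \<open>The rotation preserves both Lebesgue measure and the unit ball, hence the uniform
  measure on the ball, and it commutes with \<open>sgn\<close> because it preserves norms.\<close>

lemma sphere_measure_C2_rotation:
  assumes "0 < \<theta>" "\<theta> < pi"
  shows "distr sphere_measure_C2 borel (cscale (cis \<theta>)) = sphere_measure_C2"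
proof -
  let ?R = "cscale (cis \<theta>)" and ?U = "uniform_measure lborel (ball 0 1) :: (complex \<times> complex) measure"
  have inv: "distr lborel borel ?R = lborel"
    using lborel_C2_rotation[OF assms] by (simp add: cscale_def[abs_def])
  have U: "distr ?U borel ?R = ?U"
  proof (rule measure_eqI)
    fix X assume "X \<in> sets (distr ?U borel ?R)"
    then have [measurable]: "X \<in> sets borel" by simp
    have [measurable]: "?R -` X \<in> sets borel"
      using measurable_sets[OF cscale_measurable, of X "cis \<theta>"] by simp
    have eq: "?R -` (ball 0 1 \<inter> X) = ball 0 1 \<inter> ?R -` X"
      by (simp add: set_eq_iff norm_cscale)
    have "emeasure lborel (ball 0 1 \<inter> X) = emeasure (distr lborel borel ?R) (ball 0 1 \<inter> X)"
      by (simp add: inv)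
    also have "\<dots> = emeasure lborel (ball 0 1 \<inter> ?R -` X)"
      by (subst emeasure_distr) (auto simp: eq simp del: vimage_Int)
    finally show "emeasure (distr ?U borel ?R) X = emeasure ?U X"
      by (simp add: emeasure_distr)
  qed simp
  have sgn: "sgn (?R x) = ?R (sgn x)" for x
    by (simp add: sgn_div_norm norm_cscale cscale_scaleR)
  have "distr sphere_measure_C2 borel ?R = distr ?U borel (?R \<circ> sgn)"
    unfolding sphere_measure_C2_def by (subst distr_distr) auto
  also have "\<dots> = distr (distr ?U borel ?R) borel sgn"
    by (subst distr_distr) (auto simp: sgn comp_def)
  finally show ?thesis by (simp add: U sphere_measure_C2_def)
qed

text \<open>Rotating the variable leaves the integral unchanged but also multiplies it by
  \<open>cis (k * \<theta>)\<close>; one angle for which this factor is not 1 suffices.\<close>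

lemma integral_sphere_C2_weight_eq_0:
  fixes g :: "complex \<times> complex \<Rightarrow> complex"
  assumes g: "continuous_on UNIV g"
    and weight: "\<And>\<theta> z. g (cscale (cis \<theta>) z) = cis (k * \<theta>) * g z"
    and k: "\<bar>k\<bar> \<ge> 1"
  shows "(\<integral>x. g x \<partial>sphere_measure_C2) = 0"
proof -
  \<comment> \<open>Chosen so that \<open>\<bar>k\<bar> * \<theta>\<close> is a third of a full
    turn; \<open>\<bar>k\<bar> \<ge> 1\<close> keeps \<open>\<theta>\<close> below
    \<open>pi\<close>.\<close>
  define \<theta> where "\<theta> = 2 * pi / (3 * \<bar>k\<bar>)"
  have \<theta>: "0 < \<theta>" "\<theta> < pi" using k by (auto simp: \<theta>_def field_simps)
  have gm: "g \<in> borel_measurable borel" by (rule borel_measurable_continuous_onI[OF g])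
  have "(\<integral>x. g x \<partial>sphere_measure_C2) = (\<integral>x. g x \<partial>distr sphere_measure_C2 borel (cscale (cis \<theta>)))"
    by (simp add: sphere_measure_C2_rotation[OF \<theta>])
  also have "\<dots> = (\<integral>x. g (cscale (cis \<theta>) x) \<partial>sphere_measure_C2)"
    using gm by (subst integral_distr) auto
  also have "\<dots> = cis (k * \<theta>) * (\<integral>x. g x \<partial>sphere_measure_C2)"
    by (simp add: weight)
  finally have "(\<integral>x. g x \<partial>sphere_measure_C2) = 0 \<or> cis (k * \<theta>) = 1"
    by (metis mult_cancel_right1)
  moreover have "cos (k * \<theta>) = cos (2 * pi / 3)"
  proof -
    have "\<bar>k * \<theta>\<bar> = 2 * pi / 3"
      using k by (simp add: \<theta>_def abs_mult)
    then show ?thesis by (metis cos_abs_real)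
  qed
  ultimately show ?thesis by (auto simp: complex_eq_iff cos_120)
qed

text \<open>By homogeneity \<open>g y\<close> vanishes whenever \<open>g (sgn y)\<close> does, so
  the points of the unit ball where \<open>g\<close> is nonzero form a null set. This set is open,
  hence empty, and homogeneity extends the vanishing beyond the ball.\<close>

lemma AE_sphere_C2_homogeneous_eq_0:
  fixes g :: "complex \<times> complex \<Rightarrow> complex"
  assumes g: "continuous_on UNIV g"
    and hom: "\<And>\<mu> z. g (cscale \<mu> z) = \<mu> ^ n * g z"
    and AE: "AE x in sphere_measure_C2. g x = 0"
  shows "g z = 0"
proof -
  have gm[measurable]: "g \<in> borel_measurable borel" by (rule borel_measurable_continuous_onI[OF g])
  have "AE y in uniform_measure lborel (ball 0 1). g (sgn y) = 0"
    using AE unfolding sphere_measure_C2_def by (subst (asm) AE_distr_iff) auto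
  then have "AE y in lborel. y \<in> ball 0 1 \<longrightarrow> g (sgn y) = 0"
    using ball_C2_emeasure by (subst (asm) AE_uniform_measure) (auto simp: top.not_eq_extremum)
  then have "AE y in lborel. y \<notin> ball 0 1 \<inter> {y. g y \<noteq> 0}"
  proof eventually_elim
    case (elim y)
    have "g y = g (cscale (of_real (norm y)) (sgn y))"
      by (cases "y = 0") (simp_all add: cscale_of_real sgn_div_norm cscale_def[of 0] zero_prod_def)
    then show ?case using elim by (auto simp: hom)
  qed
  then have "ball 0 1 \<inter> {y. g y \<noteq> 0} \<in> null_sets lborel"
    by (subst (asm) AE_iff_null_sets[symmetric]) auto
  moreover have op: "open (ball 0 1 \<inter> {y. g y \<noteq> 0})"
    using g by (intro open_Int open_ball open_Collect_neq continuous_on_const)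
  ultimately have e: "ball 0 1 \<inter> {y. g y \<noteq> 0} = {}"
    using open_not_negligible negligible_iff_null_sets null_sets_completionI by blast
  show ?thesis
  proof -
    \<comment> \<open>A positive factor that shrinks \<open>z\<close> into the open unit
      ball.\<close>
    let ?r = "1 / (1 + norm z)"
    have "1 + norm z > 0" using norm_ge_zero[of z] by linarith
    then have "?r *\<^sub>R z \<in> ball 0 1"
      by (simp add: field_simps)
    with e have "g (cscale (of_real ?r) z) = 0" unfolding cscale_of_real by blast
    moreover have "complex_of_real ?r \<noteq> 0" by (smt (verit) norm_ge_zero of_real_eq_0_iff zero_less_divide_1_iff)
    ultimately show ?thesis unfolding hom by simp
  qed
qed

subsection \<open>Slicewise holomorphic functions\<close>

text \<open>Cauchy's inequality turns uniform closeness of \<open>F _ x\<close> and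
  \<open>F _ b\<close> on a disc into closeness of their derivatives.\<close>

lemma continuous_on_deriv_param:
  fixes F :: "complex \<Rightarrow> 'a::metric_space \<Rightarrow> complex"
  assumes cont: "continuous_on UNIV (\<lambda>(w, x). F w x)"
    and hol: "\<And>x. (\<lambda>w. F w x) holomorphic_on UNIV"
  shows "continuous_on UNIV (\<lambda>(w, x). deriv (\<lambda>w. F w x) w)"
  unfolding continuous_on_iff
proof clarsimp
  fix a :: complex and b :: 'a and e :: real
  assume e: "e > 0"
  \<comment> \<open>Radius 2 is used because the closed unit disc about any \<open>w\<close> with
    \<open>dist w a < 1\<close> lies in \<open>cball a 2\<close>; compactness makes the closeness
    uniform on that disc.\<close>
  have "continuous_on (UNIV \<times> cball a 2) (\<lambda>(x, w). F w x)"
    using continuous_on_compose2[OF cont continuous_on_swap, of "UNIV \<times> cball a 2"]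
    by (simp add: case_prod_beta')
  from continuous_on_prod_compactE[OF this compact_cball UNIV_I[of b] half_gt_zero[OF e]]
  obtain X where "b \<in> X" "open X"
    "\<forall>x\<in>X \<inter> UNIV. \<forall>w\<in>cball a 2. dist (case (x, w) of (x, w) \<Rightarrow> F w x) (case (b, w) of (x, w) \<Rightarrow> F w x) \<le> e / 2"
    by blast
  then have X: "b \<in> X" "open X" "\<And>x w. x \<in> X \<Longrightarrow> w \<in> cball a 2 \<Longrightarrow> dist (F w x) (F w b) \<le> e / 2"
    by simp_all
  obtain d1 where d1: "d1 > 0" "ball b d1 \<subseteq> X" using X open_contains_ball by blast
  have "continuous_on UNIV (deriv (\<lambda>w. F w b))"
    by (intro holomorphic_on_imp_continuous_on holomorphic_deriv hol) auto
  then obtain d2 where d2: "d2 > 0"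
    "\<And>w. dist w a < d2 \<Longrightarrow> dist (deriv (\<lambda>w. F w b) w) (deriv (\<lambda>w. F w b) a) < e / 2"
    unfolding continuous_on_iff using e by (metis UNIV_I half_gt_zero)
  show "\<exists>d>0. \<forall>w x. dist (w, x) (a, b) < d \<longrightarrow> dist (deriv (\<lambda>w. F w x) w) (deriv (\<lambda>w. F w b) a) < e"
  proof (intro exI[of _ "min 1 (min d1 d2)"] conjI allI impI)
    fix w x assume "dist (w, x) (a, b) < min 1 (min d1 d2)"
    then have d: "dist w a < 1" "dist w a < d2" "dist x b < d1"
      using dist_fst_le[of "(w, x)" "(a, b)"] dist_snd_le[of "(w, x)" "(a, b)"] by auto
    have x: "x \<in> X" using d d1 by (auto simp: dist_commute subset_iff)
    have dif: "(\<lambda>w. F w x) field_differentiable at w" "(\<lambda>w. F w b) field_differentiable at w"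
      using hol by (auto simp: holomorphic_on_def)
    have "norm ((deriv ^^ 1) (\<lambda>u. F u x - F u b) w) \<le> fact 1 * (e / 2) / 1 ^ 1"
    proof (rule Cauchy_inequality)
      show "(\<lambda>u. F u x - F u b) holomorphic_on ball w 1"
        by (intro holomorphic_intros holomorphic_on_subset[OF hol]) auto
      show "continuous_on (cball w 1) (\<lambda>u. F u x - F u b)"
        by (intro holomorphic_on_imp_continuous_on holomorphic_intros holomorphic_on_subset[OF hol]) auto
      fix u assume "cmod (w - u) = 1"
      then have "dist a u \<le> 2" using d(1) dist_triangle[of a u w] by (simp add: dist_norm norm_minus_commute)
      then show "cmod (F u x - F u b) \<le> e / 2" using X(3)[OF x, of u] by (simp add: dist_norm)
    qed simp
    then have "dist (deriv (\<lambda>w. F w x) w) (deriv (\<lambda>w. F w b) w) \<le> e / 2"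
      using dif by (simp add: dist_norm)
    with d2(2)[OF d(2)] show "dist (deriv (\<lambda>w. F w x) w) (deriv (\<lambda>w. F w b) a) < e"
      using dist_triangle[of "deriv (\<lambda>w. F w x) w" "deriv (\<lambda>w. F w b) a" "deriv (\<lambda>w. F w b) w"] by linarith
  qed (use d1 d2 in auto)
qed

lemma continuous_on_higher_deriv_param:
  fixes F :: "complex \<Rightarrow> 'a::metric_space \<Rightarrow> complex"
  assumes "continuous_on UNIV (\<lambda>(w, x). F w x)"
    and "\<And>x. (\<lambda>w. F w x) holomorphic_on UNIV"
  shows "continuous_on UNIV (\<lambda>(w, x). (deriv ^^ n) (\<lambda>w. F w x) w)"
  using assms
proof (induction n arbitrary: F)
  case (Suc n)
  have "continuous_on UNIV (\<lambda>(w, x). (deriv ^^ n) (\<lambda>w. deriv (\<lambda>w. F w x) w) w)"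
    using Suc.prems by (intro Suc.IH continuous_on_deriv_param holomorphic_deriv) auto
  then show ?case by (simp add: funpow_swap1 del: funpow.simps add: funpow.simps(2)[of n deriv])
qed simp

text \<open>Where \<open>G\<close> is nonzero, its difference quotient is that of its square divided
  by \<open>G w + G z\<close>. Unless \<open>G\<close> vanishes identically, its zeros are isolated
  and, by continuity, removable singularities.\<close>

lemma holomorphic_continuous_square_root:
  assumes G: "continuous_on UNIV G" and sq: "(\<lambda>z. (G z)\<^sup>2) holomorphic_on UNIV"
  shows "G holomorphic_on UNIV"
proof -
  have nz: "G field_differentiable at z" if "G z \<noteq> 0" for z
  proof -
    obtain D where D: "((\<lambda>w. (G w)\<^sup>2) has_field_derivative D) (at z)"
      using sq by (auto simp: holomorphic_on_def field_differentiable_def)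
    have GG: "(G \<longlongrightarrow> G z) (at z)" using G by (simp add: continuous_on_def)
    have "((\<lambda>w. ((G w)\<^sup>2 - (G z)\<^sup>2) / (w - z) / (G w + G z)) \<longlongrightarrow> D / (G z + G z)) (at z)"
      using D that unfolding has_field_derivative_iff by (intro tendsto_intros GG) auto
    moreover have "\<forall>\<^sub>F w in at z. G w + G z \<noteq> 0"
      using that by (intro tendsto_imp_eventually_ne[of _ "G z + G z"] tendsto_intros GG) auto
    then have "\<forall>\<^sub>F w in at z. ((G w)\<^sup>2 - (G z)\<^sup>2) / (w - z) / (G w + G z) = (G w - G z) / (w - z)"
      by eventually_elim (simp add: square_diff_square_factored power2_eq_square)
    ultimately have "((\<lambda>w. (G w - G z) / (w - z)) \<longlongrightarrow> D / (G z + G z)) (at z)"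
      by (rule Lim_transform_eventually)
    then show ?thesis by (auto simp: has_field_derivative_iff field_differentiable_def)
  qed
  show ?thesis
  proof (cases "\<forall>z. G z = 0")
    case True
    then have "G = (\<lambda>_. 0)" by auto
    then show ?thesis by simp
  next
    case False
    then obtain b where b: "G b \<noteq> 0" by auto
    have "G field_differentiable at z" for z
    proof (cases "G z = 0")
      case True
      obtain r where r: "r > 0" "\<And>w. w \<in> ball z r - {z} \<Longrightarrow> (G w)\<^sup>2 \<noteq> 0"
        using isolated_zeros[OF sq, of z b] True b by auto
      have "G holomorphic_on ball z r"
      proof (rule no_isolated_singularity)
        show "G holomorphic_on ball z r - {z}"
          using r nz by (auto simp: holomorphic_on_def intro: field_differentiable_at_within)
      qed (auto intro: continuous_on_subset[OF G])
      then show ?thesis using r(1) by (metis centre_in_ball holomorphic_on_imp_differentiable_at open_ball)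
    qed (use nz in auto)
    then show ?thesis by (simp add: holomorphic_on_def)
  qed
qed

text \<open>A nowhere zero entire function has a holomorphic logarithm \<open>l\<close>; the
  continuous function \<open>w - l\<close> takes values in a discrete set and is therefore
  constant.\<close>

lemma holomorphic_continuous_logarithm:
  assumes w: "continuous_on UNIV w" and ex: "(\<lambda>z. exp (w z)) holomorphic_on UNIV"
  shows "w holomorphic_on UNIV"
proof -
  obtain l where l: "l holomorphic_on UNIV" "\<And>z. exp (w z) = exp (l z)"
    using contractible_imp_holomorphic_log[OF ex contractible_UNIV] by (metis UNIV_I exp_not_eq_zero)
  have "(\<lambda>z. w z - l z) constant_on UNIV"
  proof (rule continuous_discrete_range_constant)
    show "continuous_on UNIV (\<lambda>z. w z - l z)"
      by (intro continuous_on_diff w holomorphic_on_imp_continuous_on l)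
    fix x :: complex
    have "\<exists>n::int. w z - l z = of_int (2 * n) * (of_real pi * \<i>)" for z
      using l(2)[of z] unfolding exp_eq by (metis add_diff_cancel_left' mult.assoc of_real_mult of_real_of_int_eq)
    then obtain n where n: "\<And>z. w z - l z = of_int (2 * n z) * (of_real pi * \<i>)" by metis
    \<comment> \<open>Distinct multiples of \<open>2 * pi * \<i>\<close> lie at least
      \<open>2 * pi\<close> apart, so 1 serves as a separation constant.\<close>
    have "1 \<le> cmod (w y - l y - (w x - l x))" if ne: "w y - l y \<noteq> w x - l x" for y
    proof -
      have "w y - l y - (w x - l x) = of_int (2 * (n y - n x)) * (of_real pi * \<i>)"
        unfolding n by (simp add: algebra_simps)
      then have c: "cmod (w y - l y - (w x - l x)) = \<bar>of_int (2 * (n y - n x))\<bar> * pi"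
        by (simp only: norm_mult norm_of_int norm_of_real norm_ii) simp
      have "n y \<noteq> n x" using ne n by metis
      then have "\<bar>2 * (n y - n x)\<bar> \<ge> 1" by presburger
      then have "\<bar>of_int (2 * (n y - n x))\<bar> \<ge> (1::real)" by (metis of_int_1_le_iff of_int_abs)
      then have "1 * 1 \<le> \<bar>of_int (2 * (n y - n x))\<bar> * pi"
        using pi_gt3 by (intro mult_mono) auto
      then show ?thesis unfolding c by simp
    qed
    then show "\<exists>e>0. \<forall>y. y \<in> UNIV \<and> w y - l y \<noteq> w x - l x \<longrightarrow> e \<le> cmod (w y - l y - (w x - l x))"
      by (intro exI[of _ 1]) auto
  qed (rule connected_UNIV)
  then obtain c where c: "\<And>z. w z - l z = c" unfolding constant_on_def by blast
  have "w = (\<lambda>z. l z + c)" using c by (intro ext) (metis add.commute diff_add_cancel)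
  then show ?thesis using l(1) by (auto intro: holomorphic_intros)
qed

subsection \<open>Growth from spherical means\<close>

text \<open>Expand \<open>v\<close> into homogeneous parts \<open>P n\<close>. The mean of
  \<open>\<bar>Im v\<bar>\<close> bounds \<open>r ^ n\<close> times the squared L2 norm of
  \<open>P n\<close> by a multiple of \<open>r ^ K\<close>, so letting \<open>r\<close> grow kills
  every part with \<open>n > K\<close>.\<close>

lemma polynomial_growth_of_sphere_mean:
  fixes v :: "complex \<times> complex \<Rightarrow> complex"
  assumes cont: "continuous_on UNIV v"
    and hol: "\<And>z. (\<lambda>\<zeta>. v (cscale \<zeta> z)) holomorphic_on UNIV"
    and mean: "\<And>r. r \<ge> r0 \<Longrightarrow> (\<integral>x. \<bar>Im (v (r *\<^sub>R x))\<bar> \<partial>sphere_measure_C2) \<le> r ^ K"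
  obtains C where "\<And>z. cmod (v z) \<le> C * (1 + norm z) ^ K"
proof -
  \<comment> \<open>The homogeneous parts are read off as one-variable Taylor coefficients at 0
    along complex lines through the origin.\<close>
  define P where "P = (\<lambda>n z. (deriv ^^ n) (\<lambda>\<zeta>. v (cscale \<zeta> z)) 0 / fact n)"
  have hol': "(\<lambda>\<zeta>. v (cscale \<zeta> z)) holomorphic_on S" for S z
    by (rule holomorphic_on_subset[OF hol]) simp
  have Pcont: "continuous_on S (P n)" for n S
  proof -
    have "continuous_on UNIV (\<lambda>(\<zeta>, z). (deriv ^^ n) (\<lambda>\<zeta>. v (cscale \<zeta> z)) \<zeta>)"
      by (rule continuous_on_higher_deriv_param[of "\<lambda>\<zeta> z. v (cscale \<zeta> z)", OF _ hol])
         (auto simp: case_prod_beta' intro!: continuous_intros continuous_on_compose2[OF cont])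
    from continuous_on_compose2[OF this, of UNIV "\<lambda>z. (0, z)"]
    have "continuous_on UNIV (\<lambda>z. (deriv ^^ n) (\<lambda>\<zeta>. v (cscale \<zeta> z)) 0)"
      by (simp add: continuous_on_Pair continuous_on_const continuous_on_id)
    then have "continuous_on UNIV (P n)"
      unfolding P_def by (intro continuous_intros) auto
    then show ?thesis by (rule continuous_on_subset) auto
  qed
  have Phom: "P n (cscale \<mu> z) = \<mu> ^ n * P n z" for n \<mu> z
  proof -
    have "(\<lambda>\<zeta>. v (cscale \<zeta> (cscale \<mu> z))) = (\<lambda>\<zeta>. v (cscale (\<mu> * \<zeta>) z))"
      by (simp add: cscale_cscale mult.commute)
    then show ?thesis
      using higher_deriv_compose_linear[OF hol, of UNIV 0 \<mu> n z] by (simp add: P_def)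
  qed
  have Psums: "(\<lambda>n. P n z * \<zeta> ^ n) sums v (cscale \<zeta> z)" for z \<zeta>
    using holomorphic_power_series[OF hol', of \<zeta> 0 "norm \<zeta> + 1" z]
    unfolding P_def by simp
  have "\<exists>M\<ge>0. \<forall>z. norm z \<le> 1 \<longrightarrow> cmod (P n z) \<le> M" for n
  proof -
    have "bounded (P n ` cball 0 1)"
      by (intro compact_imp_bounded compact_continuous_image Pcont compact_cball)
    then obtain M where "\<And>z. z \<in> cball 0 1 \<Longrightarrow> cmod (P n z) \<le> M"
      unfolding bounded_iff by blast
    then show ?thesis
      by (intro exI[of _ "max 0 M"] conjI allI impI) (simp_all add: le_max_iff_disj)
  qed
  then obtain M where M: "\<And>n. M n \<ge> 0" "\<And>n z. norm z \<le> 1 \<Longrightarrow> cmod (P n z) \<le> M n"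
    by metis
  \<comment> \<open>Applying Cauchy's inequality at radius \<open>2 * r\<close> rather than
    \<open>r\<close> gains the factor \<open>1 / 2 ^ n\<close>, a geometric majorant on the sphere
    of radius \<open>r\<close>.\<close>
  have Pbound: "\<exists>B\<ge>0. \<forall>n z. norm z \<le> 1 \<longrightarrow> cmod (P n z) * r ^ n \<le> B / 2 ^ n" if r: "r > 0" for r
  proof -
    have "bounded (v ` cball 0 (2 * r))"
      by (intro compact_imp_bounded compact_continuous_image continuous_on_subset[OF cont]) auto
    then obtain B where B: "\<And>z. z \<in> cball 0 (2 * r) \<Longrightarrow> cmod (v z) \<le> B"
      unfolding bounded_iff by blast
    have "cmod (P n z) * r ^ n \<le> B / 2 ^ n" if z: "norm z \<le> 1" for n z
    proof -
      have "norm ((deriv ^^ n) (\<lambda>\<zeta>. v (cscale \<zeta> z)) 0) \<le> fact n * B / (2 * r) ^ n"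
      proof (rule Cauchy_inequality)
        fix \<zeta> assume "cmod (0 - \<zeta>) = 2 * r"
        then have "norm (cscale \<zeta> z) \<le> 2 * r"
          using z r by (simp add: norm_cscale mult_left_le)
        then show "cmod (v (cscale \<zeta> z)) \<le> B" using B by simp
      qed (use r in \<open>auto intro: hol' holomorphic_on_imp_continuous_on\<close>)
      then show ?thesis
        using r by (simp add: P_def norm_divide field_simps power_mult_distrib)
    qed
    moreover have "B \<ge> 0" using order_trans[OF norm_ge_zero B[of 0]] r by simp
    ultimately show ?thesis by auto
  qed
  \<comment> \<open>\<open>P n\<close> is the homogeneous part of degree \<open>n\<close>. Integrating \<open>v - cnj v\<close> against \<open>cnj (P n)\<close> over a sphere
    isolates it, since \<open>P m * cnj (P n)\<close> has weight \<open>m - n\<close> and \<open>cnj (P m) * cnj (P n)\<close> has weight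
    \<open>- (m + n) \<noteq> 0\<close> under rotation.\<close>
  have I0: "(\<integral>x. (cmod (P n x))\<^sup>2 \<partial>sphere_measure_C2) = 0" if n: "n > K" for n
  proof -
    define I where "I = (\<integral>x. (cmod (P n x))\<^sup>2 \<partial>sphere_measure_C2)"
    \<comment> \<open>The quantity \<open>r ^ n * I\<close> is the one surviving term when
      \<open>v - cnj v = 2 * \<i> * Im v\<close> is integrated against \<open>cnj (P n)\<close>, and
      \<open>M n\<close> bounds that second factor.\<close>
    have est: "r ^ n * I \<le> 2 * M n * r ^ K" if r: "r \<ge> r0" "r > 0" for r
    proof -
      obtain B where B: "B \<ge> 0" "\<And>m z. norm z \<le> 1 \<Longrightarrow> cmod (P m z) * r ^ m \<le> B / 2 ^ m"
        using Pbound[OF r(2)] by auto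
      define c where "c = (complex_of_real r)"
      define t where "t = (\<lambda>m x. (P m x * c ^ m - cnj (P m x * c ^ m)) * cnj (P n x))"
      have cr: "cmod c = r" "cnj c = c" using r by (auto simp: c_def)
      have tcont: "continuous_on UNIV (t m)" for m
        unfolding t_def by (intro continuous_intros Pcont)
      have tint: "integrable sphere_measure_C2 (t m)" for m
        by (rule integrable_sphere_measure_C2[OF tcont])
      have tnorm: "norm (t m x) \<le> 2 * B * M n * (1 / 2) ^ m" if x: "norm x \<le> 1" for m x
      proof -
        have "cmod (P m x * c ^ m - cnj (P m x * c ^ m)) \<le> cmod (P m x * c ^ m) + cmod (cnj (P m x * c ^ m))"
          by (rule norm_triangle_ineq4)
        from mult_right_mono[OF this norm_ge_zero[of "cnj (P n x)"]]
        have "norm (t m x) \<le> (cmod (P m x * c ^ m) + cmod (cnj (P m x * c ^ m))) * cmod (P n x)"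
          unfolding t_def norm_mult[of _ "cnj (P n x)"] by simp
        also have "\<dots> = 2 * (cmod (P m x) * r ^ m) * cmod (P n x)"
          by (simp add: norm_mult norm_power cr)
        also have "\<dots> \<le> 2 * (B / 2 ^ m) * M n"
          using B M x r by (intro mult_mono) auto
        finally show ?thesis by (simp add: power_divide)
      qed
      have sg: "summable (\<lambda>m. 2 * B * M n * (1 / 2) ^ m)"
        by (intro summable_mult summable_geometric) auto
      have tsums: "(\<lambda>m. t m x) sums (2 * \<i> * of_real (Im (v (r *\<^sub>R x))) * cnj (P n x))" for x
      proof -
        have s: "(\<lambda>m. P m x * c ^ m) sums v (r *\<^sub>R x)"
          using Psums[of x c] by (simp add: c_def cscale_of_real)
        then have "(\<lambda>m. cnj (P m x * c ^ m)) sums cnj (v (r *\<^sub>R x))"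
          by (simp only: sums_cnj)
        with s have "(\<lambda>m. t m x) sums ((v (r *\<^sub>R x) - cnj (v (r *\<^sub>R x))) * cnj (P n x))"
          unfolding t_def by (intro sums_mult2 sums_diff)
        also have "v (r *\<^sub>R x) - cnj (v (r *\<^sub>R x)) = 2 * \<i> * of_real (Im (v (r *\<^sub>R x)))"
          by (simp add: complex_diff_cnj mult.assoc mult.commute)
        finally show ?thesis .
      qed
      \<comment> \<open>Sum and integral may be interchanged because the terms are dominated by the
        summable geometric majorant.\<close>
      have "(\<lambda>m. \<integral>x. t m x \<partial>sphere_measure_C2) sums (\<integral>x. (\<Sum>m. t m x) \<partial>sphere_measure_C2)"
      proof (rule sums_integral[OF tint])
        show "AE x in sphere_measure_C2. summable (\<lambda>m. norm (t m x))"
          using AE_sphere_measure_C2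
        proof eventually_elim
          case (elim x)
          show ?case by (rule summable_comparison_test_ev[OF _ sg]) (use tnorm elim in auto)
        qed
        show "summable (\<lambda>m. \<integral>x. norm (t m x) \<partial>sphere_measure_C2)"
        proof (rule summable_comparison_test_ev[OF always_eventually sg], intro allI)
          fix m
          have "(\<integral>x. norm (t m x) \<partial>sphere_measure_C2) \<le> (\<integral>x. 2 * B * M n * (1 / 2) ^ m \<partial>sphere_measure_C2)"
            using AE_sphere_measure_C2 tnorm
            by (intro integral_mono_AE integrable_norm tint) auto
          then show "norm (\<integral>x. norm (t m x) \<partial>sphere_measure_C2) \<le> 2 * B * M n * (1 / 2) ^ m"
            by (simp add: measure_def emeasure_sphere_measure_C2_UNIV)
        qed
      qed
      also have "(\<lambda>x. \<Sum>m. t m x) = (\<lambda>x. 2 * \<i> * of_real (Im (v (r *\<^sub>R x))) * cnj (P n x))"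
        using tsums by (auto simp: sums_iff)
      finally have s1: "(\<lambda>m. \<integral>x. t m x \<partial>sphere_measure_C2) sums
        (\<integral>x. 2 * \<i> * of_real (Im (v (r *\<^sub>R x))) * cnj (P n x) \<partial>sphere_measure_C2)" .
      have cispow: "cis (real j * \<theta>) = cis \<theta> ^ j" for j \<theta> by (rule Complex.DeMoivre[symmetric])
      have part1: "(\<integral>x. P m x * c ^ m * cnj (P n x) \<partial>sphere_measure_C2) = 0" if "m \<noteq> n" for m
      proof (rule integral_sphere_C2_weight_eq_0[where k = "real m - real n"])
        show "\<bar>real m - real n\<bar> \<ge> 1" using that by linarith
        fix \<theta> z
        have "cis ((real m - real n) * \<theta>) = cis \<theta> ^ m * cnj (cis \<theta> ^ n)"
          unfolding cispow[symmetric] cis_cnj cis_mult by (simp add: left_diff_distrib)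
        then show "P m (cscale (cis \<theta>) z) * c ^ m * cnj (P n (cscale (cis \<theta>) z)) =
          cis ((real m - real n) * \<theta>) * (P m z * c ^ m * cnj (P n z))"
          by (simp add: Phom)
      qed (intro continuous_intros Pcont)
      have part2: "(\<integral>x. cnj (P m x * c ^ m) * cnj (P n x) \<partial>sphere_measure_C2) = 0" for m
      proof (rule integral_sphere_C2_weight_eq_0[where k = "- (real m + real n)"])
        show "\<bar>- (real m + real n)\<bar> \<ge> 1" using n by linarith
        fix \<theta> z
        have "cis (- (real m + real n) * \<theta>) = cnj (cis \<theta> ^ m) * cnj (cis \<theta> ^ n)"
          unfolding cispow[symmetric] cis_cnj cis_mult by (simp add: algebra_simps)
        then show "cnj (P m (cscale (cis \<theta>) z) * c ^ m) * cnj (P n (cscale (cis \<theta>) z)) =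
          cis (- (real m + real n) * \<theta>) * (cnj (P m z * c ^ m) * cnj (P n z))"
          by (simp add: Phom)
      qed (intro continuous_intros Pcont)
      have split: "(\<integral>x. t m x \<partial>sphere_measure_C2) =
        (\<integral>x. P m x * c ^ m * cnj (P n x) \<partial>sphere_measure_C2)" for m
      proof -
        have "(\<integral>x. t m x \<partial>sphere_measure_C2) =
          (\<integral>x. P m x * c ^ m * cnj (P n x) \<partial>sphere_measure_C2) -
          (\<integral>x. cnj (P m x * c ^ m) * cnj (P n x) \<partial>sphere_measure_C2)"
          unfolding t_def left_diff_distrib
          by (intro Bochner_Integration.integral_diff integrable_sphere_measure_C2 continuous_intros Pcont)
        then show ?thesis by (simp only: part2) simp
      qed
      have "(\<integral>x. P n x * c ^ n * cnj (P n x) \<partial>sphere_measure_C2) = c ^ n * of_real I"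
      proof -
        have "(\<lambda>x. P n x * c ^ n * cnj (P n x)) = (\<lambda>x. c ^ n * of_real ((cmod (P n x))\<^sup>2))"
          by (simp add: fun_eq_iff complex_norm_square mult_ac del: of_real_power)
        then show ?thesis by (simp add: I_def del: of_real_power)
      qed
      then have "(\<lambda>m. \<integral>x. t m x \<partial>sphere_measure_C2) = (\<lambda>m. if m = n then c ^ n * of_real I else 0)"
        unfolding split using part1 by (intro ext) simp
      with s1 have "(\<lambda>m. if m = n then c ^ n * of_real I else 0) sums
        (\<integral>x. 2 * \<i> * of_real (Im (v (r *\<^sub>R x))) * cnj (P n x) \<partial>sphere_measure_C2)"
        by (simp only:)
      then have eq: "c ^ n * of_real I =
        (\<integral>x. 2 * \<i> * of_real (Im (v (r *\<^sub>R x))) * cnj (P n x) \<partial>sphere_measure_C2)"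
        using sums_unique2[OF sums_single[of n "\<lambda>_. c ^ n * of_real I"]] by simp
      have Ipos: "I \<ge> 0" unfolding I_def by (rule integral_nonneg_AE) auto
      have vr: "continuous_on UNIV (\<lambda>x. v (r *\<^sub>R x))"
        by (intro continuous_on_compose2[OF cont] continuous_intros) auto
      have "r ^ n * I = cmod (c ^ n * of_real I)"
        using Ipos r by (simp add: norm_mult norm_power cr)
      also have "\<dots> \<le> (\<integral>x. norm (2 * \<i> * of_real (Im (v (r *\<^sub>R x))) * cnj (P n x)) \<partial>sphere_measure_C2)"
        unfolding eq by (rule integral_norm_bound)
      also have "\<dots> \<le> (\<integral>x. 2 * M n * \<bar>Im (v (r *\<^sub>R x))\<bar> \<partial>sphere_measure_C2)"
      proof (rule integral_mono_AE)
        show "AE x in sphere_measure_C2. norm (2 * \<i> * of_real (Im (v (r *\<^sub>R x))) * cnj (P n x)) \<le> 2 * M n * \<bar>Im (v (r *\<^sub>R x))\<bar>"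
          using AE_sphere_measure_C2
        proof eventually_elim
          case (elim x)
          then show ?case using M(2)[of x n] by (simp add: norm_mult mult.commute mult_right_mono)
        qed
      qed (intro integrable_norm integrable_sphere_measure_C2 continuous_intros Pcont vr)+
      also have "\<dots> = 2 * M n * (\<integral>x. \<bar>Im (v (r *\<^sub>R x))\<bar> \<partial>sphere_measure_C2)"
        by simp
      also have "\<dots> \<le> 2 * M n * r ^ K"
        using mean[OF r(1)] M(1)[of n] by (intro mult_left_mono) auto
      finally show ?thesis .
    qed
    have "I \<le> 0"
    proof (rule ccontr)
      assume "\<not> I \<le> 0"
      \<comment> \<open>Since \<open>n > K\<close>, the estimate \<open>est\<close> would give
        \<open>r * I \<le> 2 * M n\<close>; this radius is large enough to contradict that.\<close>
      define r where "r = max r0 (max 1 (2 * M n / I + 1))"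
      have r: "r \<ge> r0" "r \<ge> 1" "r > 2 * M n / I" by (auto simp: r_def less_max_iff_disj)
      have "r ^ K * (r * I) \<le> r ^ n * I"
      proof -
        have "r ^ Suc K \<le> r ^ n" using r n by (intro power_increasing) auto
        then have "r ^ Suc K * I \<le> r ^ n * I" using \<open>\<not> I \<le> 0\<close> by (intro mult_right_mono) auto
        then show ?thesis by (simp add: mult_ac)
      qed
      also have "\<dots> \<le> r ^ K * (2 * M n)" using est[of r] r by (simp add: mult_ac)
      finally have "r * I \<le> 2 * M n" using r by (simp add: mult_le_cancel_left)
      then show False using r(3) \<open>\<not> I \<le> 0\<close> by (simp add: field_simps)
    qed
    moreover have "I \<ge> 0" unfolding I_def by (rule integral_nonneg_AE) auto
    ultimately have "I = 0" by linarith
    then show ?thesis by (simp only: I_def)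
  qed
  have P0: "P n z = 0" if "n > K" for n z
  proof (rule AE_sphere_C2_homogeneous_eq_0[OF Pcont Phom])
    have "integrable sphere_measure_C2 (\<lambda>x. (cmod (P n x))\<^sup>2)"
      by (intro integrable_sphere_measure_C2 continuous_intros Pcont)
    from integral_nonneg_eq_0_iff_AE[OF this] I0[OF that]
    show "AE x in sphere_measure_C2. P n x = 0" by auto
  qed
  \<comment> \<open>At \<open>\<zeta> = 1\<close> the expansion of \<open>v z\<close> is now a
    finite sum, and each homogeneous part is controlled by its bound on the unit ball.\<close>
  have "cmod (v z) \<le> (\<Sum>n\<le>K. M n) * (1 + norm z) ^ K" for z
  proof -
    have "(\<lambda>n. P n z) sums v z" using Psums[of z 1] by (simp add: cscale_def)
    moreover have "(\<lambda>n. P n z) sums (\<Sum>n\<le>K. P n z)" by (rule sums_finite) (auto intro: P0)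
    ultimately have "v z = (\<Sum>n\<le>K. P n z)" by (rule sums_unique2)
    also have "cmod \<dots> \<le> (\<Sum>n\<le>K. M n * (1 + norm z) ^ K)"
    proof (rule sum_norm_le)
      fix n assume n: "n \<in> {..K}"
      have "P n z = P n (cscale (of_real (norm z)) (sgn z))"
        by (cases "z = 0") (simp_all add: cscale_of_real sgn_div_norm cscale_def[of 0] zero_prod_def)
      then have "cmod (P n z) = norm z ^ n * cmod (P n (sgn z))" by (simp add: Phom norm_mult norm_power)
      also have "\<dots> \<le> (1 + norm z) ^ K * M n"
      proof (intro mult_mono M)
        have "norm z ^ n \<le> (1 + norm z) ^ n" by (intro power_mono) auto
        also have "\<dots> \<le> (1 + norm z) ^ K" using n by (intro power_increasing) auto
        finally show "norm z ^ n \<le> (1 + norm z) ^ K" .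
      qed (auto simp: norm_sgn)
      finally show "cmod (P n z) \<le> M n * (1 + norm z) ^ K" by (simp add: mult.commute)
    qed
    finally show ?thesis by (simp add: sum_distrib_right)
  qed
  then show thesis by (rule that)
qed

subsection \<open>Exponentials of polynomials\<close>

text \<open>Induction on the index set. Dividing by \<open>exp (p k)\<close> makes the
  \<open>k\<close>-th term a polynomial; once it has been differentiated away, the induction
  hypothesis applies to the exponents \<open>p i - p k\<close>, whose differences are still
  nonconstant.\<close>

lemma exp_poly_linear_independent:
  fixes p R :: "'i \<Rightarrow> complex poly"
  assumes "finite I"
    and "\<And>i j. i \<in> I \<Longrightarrow> j \<in> I \<Longrightarrow> i \<noteq> j \<Longrightarrow> degree (p i - p j) > 0"
    and "\<And>t. (\<Sum>i\<in>I. poly (R i) t * exp (poly (p i) t)) = 0"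
    and "i \<in> I"
  shows "R i = 0"
  using assms
proof (induction I arbitrary: p R i rule: finite_induct)
  case (insert k I)
  define q where "q = (\<lambda>i. p i - p k)"
  have qdeg: "degree (q i) > 0" if "i \<in> I" for i
    using insert.prems(1)[of i k] insert.hyps that unfolding q_def by auto
  have qdiff: "degree (q i - q j) > 0" if "i \<in> I" "j \<in> I" "i \<noteq> j" for i j
    using insert.prems(1)[of i j] that unfolding q_def by auto
  \<comment> \<open>A polynomial term \<open>Q\<close> disappears after differentiating often enough, and
    \<open>S \<mapsto> S' + q' S\<close> is injective when \<open>q' \<noteq> 0\<close>.\<close>
  have elim: "\<forall>i\<in>I. S i = 0"
    if "Q = 0 \<or> degree Q < N" "\<And>t. poly Q t + (\<Sum>i\<in>I. poly (S i) t * exp (poly (q i) t)) = 0"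
    for N Q and S :: "'i \<Rightarrow> complex poly"
    using that
  proof (induction N arbitrary: Q S)
    case 0
    \<comment> \<open>No degree is below 0, so here \<open>Q = 0\<close> and only the terms over
      \<open>I\<close> remain.\<close>
    then show ?case using insert.IH[of q S] qdiff by auto
  next
    case (Suc N)
    have "poly (pderiv Q) t + (\<Sum>i\<in>I. poly (pderiv (S i) + pderiv (q i) * S i) t * exp (poly (q i) t)) = 0" for t
    proof -
      have d: "((\<lambda>t. poly Q t + (\<Sum>i\<in>I. poly (S i) t * exp (poly (q i) t))) has_field_derivative
        poly (pderiv Q) t + (\<Sum>i\<in>I. poly (pderiv (S i) + pderiv (q i) * S i) t * exp (poly (q i) t))) (at t)"
        by (auto intro!: derivative_eq_intros sum.cong simp: algebra_simps)
      then have "((\<lambda>_. 0) has_field_derivative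
        poly (pderiv Q) t + (\<Sum>i\<in>I. poly (pderiv (S i) + pderiv (q i) * S i) t * exp (poly (q i) t))) (at t)"
        by (simp only: Suc.prems(2))
      then show ?thesis using DERIV_unique DERIV_const by blast
    qed
    moreover have "pderiv Q = 0 \<or> degree (pderiv Q) < N"
      using Suc.prems(1) by (auto simp: degree_pderiv pderiv_eq_0_iff)
    ultimately have *: "\<forall>i\<in>I. pderiv (S i) + pderiv (q i) * S i = 0"
      by (intro Suc.IH) auto
    show ?case
    proof (rule ballI, rule ccontr)
      \<comment> \<open>Compare degrees: \<open>pderiv (S i)\<close> would have degree at least that
        of \<open>S i\<close>, whereas differentiation lowers a positive degree.\<close>
      fix i assume i: "i \<in> I" "S i \<noteq> 0"
      have nz: "pderiv (q i) \<noteq> 0" using qdeg[OF i(1)] by (simp add: pderiv_eq_0_iff)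
      have eq: "pderiv (S i) = - (pderiv (q i) * S i)" using * i by (simp add: eq_neg_iff_add_eq_0)
      then have "pderiv (S i) \<noteq> 0" using nz i by auto
      then have "degree (S i) > 0" by (simp add: pderiv_eq_0_iff)
      moreover have "degree (pderiv (S i)) = degree (pderiv (q i)) + degree (S i)"
        unfolding eq by (simp add: degree_mult_eq nz i)
      ultimately show False by (simp add: degree_pderiv)
    qed
  qed
  have main: "poly (R k) t + (\<Sum>i\<in>I. poly (R i) t * exp (poly (q i) t)) = 0" for t
  proof -
    have "exp (poly (p k) t) * (poly (R k) t + (\<Sum>i\<in>I. poly (R i) t * exp (poly (q i) t)))
      = (\<Sum>i\<in>insert k I. poly (R i) t * exp (poly (p i) t))"
      using insert.hyps
      by (simp add: q_def exp_diff distrib_left sum_distrib_left mult_ac)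
    then show ?thesis using insert.prems(2) by simp
  qed
  have RI: "\<forall>i\<in>I. R i = 0"
    using elim[of "R k" "Suc (degree (R k))" R] main by auto
  have "poly (R k) t = 0" for t
    using main[of t] RI by simp
  then have "R k = 0" by (metis poly_all_0_iff_0)
  with RI insert.prems(3) show ?case by auto
qed simp

text \<open>Euler's formula gives a linear relation among the exponentials of
  \<open>\<i>\<phi>\<close>, \<open>-\<i>\<phi>\<close>, \<open>\<i>\<psi>\<close>,
  \<open>-\<i>\<psi>\<close>. With \<open>\<phi>\<close> nonconstant, independence forces two
  exponents to agree up to a constant, and comparing coefficients then determines
  \<open>pderiv \<phi>\<close>.\<close>

lemma pderiv_mult_cos_eq_cos:
  fixes \<phi> \<psi> :: "complex poly"
  assumes eq: "\<And>t. poly (pderiv \<phi>) t * cos (poly \<phi> t) = cos (poly \<psi> t)"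
  shows "\<exists>e\<in>{0, 1, -1}. pderiv \<phi> = [:e:]"
proof (cases "pderiv \<phi> = 0")
  case False
  then have d\<phi>: "degree \<phi> > 0" by (simp add: pderiv_eq_0_iff)
  have comm: "degree (a - b) = degree (b - a)" for a b :: "complex poly"
    by (metis degree_minus minus_diff_eq)
  have eq': "poly (pderiv \<phi>) t * exp (\<i> * poly \<phi> t) + poly (pderiv \<phi>) t * exp (- (\<i> * poly \<phi> t))
     = exp (\<i> * poly \<psi> t) + exp (- (\<i> * poly \<psi> t))" for t
  proof -
    have "(poly (pderiv \<phi>) t * exp (\<i> * poly \<phi> t) + poly (pderiv \<phi>) t * exp (- (\<i> * poly \<phi> t))) / 2
      = (exp (\<i> * poly \<psi> t) + exp (- (\<i> * poly \<psi> t))) / 2"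
      using eq[of t] unfolding cos_exp_eq by (simp add: distrib_left)
    then show ?thesis by (simp only: divide_cancel_right) simp
  qed
  \<comment> \<open>For constant \<open>\<psi>\<close> the right-hand side would be a term with
    exponent 0, independent of the two exponentials on the left.\<close>
  have \<psi>0: "degree \<psi> > 0"
  proof (rule ccontr)
    assume "\<not> degree \<psi> > 0"
    then obtain c where c: "\<psi> = [:c:]" by (metis degree_eq_zeroE neq0_conv)
    define p where "p = (\<lambda>i::nat. [smult \<i> \<phi>, - smult \<i> \<phi>, 0] ! i)"
    define R where "R = (\<lambda>i::nat. [pderiv \<phi>, pderiv \<phi>, [:- (exp (\<i> * c) + exp (- (\<i> * c))):]] ! i)"
    have "R 0 = 0"
    proof (rule exp_poly_linear_independent[of "{0, 1, 2}" p R])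
      fix i j :: nat assume "i \<in> {0, 1, 2}" "j \<in> {0, 1, 2}" "i \<noteq> j"
      moreover have "degree (smult \<i> \<phi> + smult \<i> \<phi>) > 0"
        using d\<phi> by (simp flip: smult_add_left)
      moreover have "degree (- smult \<i> \<phi> - smult \<i> \<phi>) > 0"
        using d\<phi> by (simp flip: smult_add_left smult_minus_left smult_diff_left)
      ultimately show "degree (p i - p j) > 0"
        using d\<phi> by (auto simp: p_def)
    next
      fix t show "(\<Sum>i\<in>{0, 1, 2}. poly (R i) t * exp (poly (p i) t)) = 0"
        using eq'[of t] by (simp add: p_def R_def c algebra_simps)
    qed auto
    then show False using False by (simp add: R_def)
  qed
  \<comment> \<open>The right-hand side is even in \<open>\<psi>\<close>, so this handles both
    \<open>\<kappa> = \<psi>\<close> and \<open>\<kappa> = - \<psi>\<close>. With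
    \<open>\<kappa> = \<phi> - c\<close> the coefficients give
    \<open>pderiv \<phi> = exp (- (\<i> * c)) = exp (\<i> * c)\<close>, whose square is 1.\<close>
  have wlog: "\<exists>e\<in>{0, 1, -1}. pderiv \<phi> = [:e:]"
    if e: "\<And>t. poly (pderiv \<phi>) t * exp (\<i> * poly \<phi> t) + poly (pderiv \<phi>) t * exp (- (\<i> * poly \<phi> t))
     = exp (\<i> * poly \<kappa> t) + exp (- (\<i> * poly \<kappa> t))" and d: "degree (\<phi> - \<kappa>) = 0" for \<kappa>
  proof -
    obtain c where "\<phi> - \<kappa> = [:c:]" using d by (metis degree_eq_zeroE)
    then have \<kappa>: "poly \<kappa> t = poly \<phi> t - c" for t
      by (metis add_diff_cancel_left' diff_add_cancel poly_diff poly_pCons poly_0 mult_zero_right add.right_neutral diff_diff_eq2)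
    define p where "p = (\<lambda>i::nat. [smult \<i> \<phi>, - smult \<i> \<phi>] ! i)"
    define R where "R = (\<lambda>i::nat. [pderiv \<phi> - [:exp (- (\<i> * c)):], pderiv \<phi> - [:exp (\<i> * c):]] ! i)"
    have R0: "R i = 0" if "i \<in> {0, 1}" for i
    proof (rule exp_poly_linear_independent[of "{0, 1}" p R])
      fix i j :: nat assume "i \<in> {0, 1}" "j \<in> {0, 1}" "i \<noteq> j"
      moreover have "degree (smult \<i> \<phi> + smult \<i> \<phi>) > 0"
        using d\<phi> by (simp flip: smult_add_left)
      moreover have "degree (- smult \<i> \<phi> - smult \<i> \<phi>) > 0"
        using d\<phi> by (simp flip: smult_add_left smult_minus_left smult_diff_left)
      ultimately show "degree (p i - p j) > 0"
        by (auto simp: p_def)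
    next
      fix t
      show "(\<Sum>i\<in>{0, 1}. poly (R i) t * exp (poly (p i) t)) = 0"
        using e[of t] by (simp add: p_def R_def \<kappa> algebra_simps exp_diff exp_add exp_minus divide_inverse)
    qed (use that in auto)
    have e1: "pderiv \<phi> = [:exp (- (\<i> * c)):]" and e2: "pderiv \<phi> = [:exp (\<i> * c):]"
      using R0[of 0] R0[of 1] by (simp_all add: R_def)
    then have "exp (- (\<i> * c)) = exp (\<i> * c)" by simp
    then have "(exp (\<i> * c))\<^sup>2 = 1" by (simp add: exp_minus power2_eq_square field_simps)
    then have "exp (\<i> * c) \<in> {0, 1, -1}" by (simp add: power2_eq_1_iff)
    with e2 show ?thesis by blast
  qed
  consider "degree (\<phi> - \<psi>) = 0" | "degree (\<phi> + \<psi>) = 0" | "degree (\<phi> - \<psi>) > 0" "degree (\<phi> + \<psi>) > 0"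
    by blast
  then show ?thesis
  proof cases
    case 1 then show ?thesis using wlog[of \<psi>] eq' by blast
  next
    case 2 then show ?thesis using wlog[of "- \<psi>"] eq' by (simp add: add.commute)
  next
    case 3
    \<comment> \<open>All four exponents now differ pairwise by nonconstant polynomials, so
      independence would give \<open>pderiv \<phi> = 0\<close>.\<close>
    define p where "p = (\<lambda>i::nat. [smult \<i> \<phi>, - smult \<i> \<phi>, smult \<i> \<psi>, - smult \<i> \<psi>] ! i)"
    define R where "R = (\<lambda>i::nat. [pderiv \<phi>, pderiv \<phi>, -1, -1] ! i)"
    have "R 0 = 0"
    proof (rule exp_poly_linear_independent[of "{0, 1, 2, 3}" p R])
      fix i j :: nat assume ij: "i \<in> {0, 1, 2, 3}" "j \<in> {0, 1, 2, 3}" "i \<noteq> j"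
      have dd: "degree (\<psi> - \<phi>) > 0" "degree (\<psi> + \<phi>) > 0" using 3 comm by (auto simp: add.commute)
      have "degree (smult \<i> \<phi> + smult \<i> \<phi>) > 0" "degree (- smult \<i> \<phi> - smult \<i> \<phi>) > 0"
        "degree (smult \<i> \<psi> + smult \<i> \<psi>) > 0" "degree (- smult \<i> \<psi> - smult \<i> \<psi>) > 0"
        using d\<phi> \<psi>0 by (simp_all flip: smult_add_left smult_minus_left smult_diff_left)
      moreover have "degree (smult \<i> \<phi> - smult \<i> \<psi>) > 0" "degree (smult \<i> \<phi> + smult \<i> \<psi>) > 0"
        "degree (smult \<i> \<psi> - smult \<i> \<phi>) > 0" "degree (smult \<i> \<psi> + smult \<i> \<phi>) > 0"
        using 3 dd by (simp_all flip: smult_add_right smult_diff_right)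
      moreover have "degree (- smult \<i> \<phi> - smult \<i> \<psi>) > 0" "degree (- smult \<i> \<phi> + smult \<i> \<psi>) > 0"
        "degree (- smult \<i> \<psi> - smult \<i> \<phi>) > 0" "degree (- smult \<i> \<psi> + smult \<i> \<phi>) > 0"
        using calculation(5-8) by (metis degree_minus minus_add_distrib diff_conv_add_uminus minus_diff_eq uminus_add_conv_diff)+
      ultimately show "degree (p i - p j) > 0"
        using ij by (auto simp: p_def)
    next
      fix t
      show "(\<Sum>i\<in>{0, 1, 2, 3}. poly (R i) t * exp (poly (p i) t)) = 0"
        using eq'[of t] by (simp add: p_def R_def algebra_simps)
    qed auto
    then show ?thesis using False by (simp add: R_def)
  qed
qed auto

subsection \<open>Solutions of finite order\<close>

lemma entire_C2_continuous: "entire_C2 f \<Longrightarrow> continuous_on S f"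
  unfolding entire_C2_def
  by (metis continuous_at_imp_continuous_on has_derivative_continuous)

lemma entire_C2_holomorphic_on_line:
  assumes "entire_C2 f"
  shows "(\<lambda>t. f (a + t * b, c + t * d)) holomorphic_on UNIV"
proof -
  have "(\<lambda>t. f (a + t * b, c + t * d)) field_differentiable at t" for t
  proof -
    obtain A B where "(f has_derivative (\<lambda>v. A * fst v + B * snd v)) (at (a + t * b, c + t * d))"
      using assms unfolding entire_C2_def by blast
    moreover have "((\<lambda>t. (a + t * b, c + t * d)) has_derivative (\<lambda>h. (h * b, h * d))) (at t)"
      by (auto intro!: derivative_eq_intros)
    ultimately have "((\<lambda>t. f (a + t * b, c + t * d)) has_derivative (\<lambda>h. A * (h * b) + B * (h * d))) (at t)"
      using has_derivative_compose[of "\<lambda>t. (a + t * b, c + t * d)" _ t UNIV f] by fastforce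
    then have "((\<lambda>t. f (a + t * b, c + t * d)) has_field_derivative (A * b + B * d)) (at t)"
      by (rule has_derivative_imp_has_field_derivative) (simp add: algebra_simps)
    then show ?thesis by (auto simp: field_differentiable_def)
  qed
  then show ?thesis by (simp add: holomorphic_on_def)
qed

lemma continuous_on_partial_z1:
  assumes "entire_C2 f"
  shows "continuous_on UNIV (\<lambda>z. partial_z1 f (fst z) (snd z))"
proof -
  have "(\<lambda>w. f (w, x)) holomorphic_on UNIV" for x
    using entire_C2_holomorphic_on_line[OF assms, of 0 1 x 0] by simp
  then show ?thesis
    using continuous_on_deriv_param[of "\<lambda>w x. f (w, x)"] entire_C2_continuous[OF assms, of UNIV]
    by (simp add: partial_z1_def case_prod_beta')
qed

section \<open>The arcsine of a solution and its growth\<close>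

text \<open>The function \<open>G + \<i> * f\<close> has inverse \<open>G - \<i> * f\<close>, so it
  has a continuous logarithm on the contractible space; \<open>- \<i>\<close> times that logarithm
  is \<open>v\<close>. Holomorphy is then recovered on each complex line separately.\<close>

lemma obtain_arcsine:
  fixes f :: "complex \<times> complex \<Rightarrow> complex"
  assumes f: "entire_C2 f"
    and eq: "\<And>z1 z2. (partial_z1 f z1 z2)\<^sup>2 + (f (z1 + c1, z2 + c2))\<^sup>2 = 1"
  obtains v where "continuous_on UNIV v" "\<And>z. f z = sin (v z)"
    "\<And>z1 z2. partial_z1 f z1 z2 = cos (v (z1 + c1, z2 + c2))"
    "\<And>a b c d. (\<lambda>t. v (a + t * b, c + t * d)) holomorphic_on UNIV"
proof -
  \<comment> \<open>Shifting the derivative back by \<open>(c1, c2)\<close> places both squares of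
    the equation at the same point.\<close>
  define G where "G = (\<lambda>z. partial_z1 f (fst z - c1) (snd z - c2))"
  have Gf: "(G z)\<^sup>2 + (f z)\<^sup>2 = 1" for z
    using eq[of "fst z - c1" "snd z - c2"] by (simp add: G_def)
  have Gcont: "continuous_on UNIV G"
    unfolding G_def
    using continuous_on_compose2[OF continuous_on_partial_z1[OF f], of UNIV "\<lambda>z. (fst z - c1, snd z - c2)"]
    by (simp add: continuous_on_Pair continuous_on_diff continuous_on_fst continuous_on_snd continuous_on_id continuous_on_const)
  define g where "g = (\<lambda>z. G z + \<i> * f z)"
  have prod: "g z * (G z - \<i> * f z) = 1" for z
    using Gf[of z] by (simp add: g_def algebra_simps power2_eq_square)
  have gnz: "g z \<noteq> 0" for z using prod[of z] by auto
  have "continuous_on UNIV g"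
    unfolding g_def by (intro continuous_intros Gcont entire_C2_continuous[OF f])
  then obtain w where w: "continuous_on UNIV w" "\<And>z. g z = exp (w z)"
    using continuous_logarithm_on_contractible[OF _ contractible_UNIV] gnz by (metis UNIV_I)
  define v where "v = (\<lambda>z. - \<i> * w z)"
  have e1: "exp (\<i> * v z) = G z + \<i> * f z" for z
    using w(2)[of z] by (simp add: v_def g_def)
  have e2: "exp (- (\<i> * v z)) = G z - \<i> * f z" for z
    using prod[of z] gnz[of z] e1[of z] by (simp add: exp_minus g_def field_simps)
  have s: "sin (v z) = f z" and c: "cos (v z) = G z" for z
    unfolding sin_exp_eq cos_exp_eq e1 e2 by simp_all
  show thesis
  proof
    show "continuous_on UNIV v" unfolding v_def by (intro continuous_intros w)
    show "f z = sin (v z)" for z by (simp add: s)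
    show "partial_z1 f z1 z2 = cos (v (z1 + c1, z2 + c2))" for z1 z2 by (simp add: c G_def)
    fix a b c d :: complex
    let ?l = "\<lambda>t. (a + t * b, c + t * d)"
    have l: "continuous_on UNIV ?l" by (intro continuous_intros)
    have fl: "(\<lambda>t. f (?l t)) holomorphic_on UNIV" by (rule entire_C2_holomorphic_on_line[OF f])
    \<comment> \<open>On a general line only continuity of \<open>G\<close> is at hand, but its
      square \<open>1 - f\<^sup>2\<close> is holomorphic there.\<close>
    have "(\<lambda>t. G (?l t)) holomorphic_on UNIV"
    proof (rule holomorphic_continuous_square_root)
      show "continuous_on UNIV (\<lambda>t. G (?l t))" by (rule continuous_on_compose2[OF Gcont l]) auto
      have "(\<lambda>t. (G (?l t))\<^sup>2) = (\<lambda>t. 1 - (f (?l t))\<^sup>2)"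
        using Gf by (simp add: fun_eq_iff eq_diff_eq)
      then show "(\<lambda>t. (G (?l t))\<^sup>2) holomorphic_on UNIV"
        by (simp only:) (intro holomorphic_on_diff holomorphic_on_power holomorphic_on_const fl)
    qed
    then have "(\<lambda>t. g (?l t)) holomorphic_on UNIV"
      unfolding g_def by (intro holomorphic_on_add holomorphic_on_mult holomorphic_on_const fl)
    then have "(\<lambda>t. exp (w (?l t))) holomorphic_on UNIV"
      by (simp only: w(2))
    moreover have "continuous_on UNIV (\<lambda>t. w (?l t))"
      by (rule continuous_on_compose2[OF w(1) l]) auto
    ultimately have "(\<lambda>t. w (?l t)) holomorphic_on UNIV"
      by (rule holomorphic_continuous_logarithm[rotated])
    then show "(\<lambda>t. v (?l t)) holomorphic_on UNIV"
      unfolding v_def by (intro holomorphic_on_mult holomorphic_on_const)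
  qed
qed

text \<open>With \<open>y = \<bar>Im z\<bar>\<close>, the two exponentials in \<open>sin z\<close>
  have moduli \<open>exp y\<close> and \<open>exp (- y) \<le> 1\<close>, so
  \<open>exp y \<le> 1 + 2 * cmod (sin z)\<close>.\<close>

lemma abs_Im_le_log_plus_sin: "\<bar>Im z\<bar> \<le> ln 4 + log_plus (cmod (sin z))"
proof -
  define y where "y = \<bar>Im z\<bar>"
  have "exp y - 1 \<le> 2 * cmod (sin z)"
  proof -
    have s: "2 * cmod (sin z) = cmod (exp (\<i> * z) - exp (- (\<i> * z)))"
      by (simp add: sin_exp_eq norm_divide norm_mult)
    have "exp (- y) \<le> 1" by (simp add: y_def)
    moreover have "\<bar>exp (- Im z) - exp (Im z)\<bar> \<le> 2 * cmod (sin z)"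
      unfolding s using norm_triangle_ineq3[of "exp (\<i> * z)" "exp (- (\<i> * z))"] by simp
    moreover have "exp y - exp (- y) \<le> \<bar>exp (- Im z) - exp (Im z)\<bar>"
      by (auto simp: y_def abs_if)
    ultimately show ?thesis by linarith
  qed
  then have "exp y \<le> 4 * max 1 (cmod (sin z))" by (simp add: max_def)
  then have "ln (exp y) \<le> ln (4 * max 1 (cmod (sin z)))" by (subst ln_le_cancel_iff) auto
  also have "\<dots> = ln 4 + log_plus (cmod (sin z))" by (simp add: log_plus_def ln_mult)
  finally show ?thesis by (simp add: y_def)
qed

lemma continuous_on_log_plus [continuous_intros]:
  "continuous_on S g \<Longrightarrow> continuous_on S (\<lambda>x. log_plus (g x))"
  unfolding log_plus_def by (intro continuous_intros) auto

text \<open>A finite limsup bounds the characteristic by \<open>r ^ n\<close> for large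
  \<open>r\<close>; the additive \<open>ln 4\<close> is absorbed by raising the exponent by
  2.\<close>

lemma finite_order_C2_sin_mean:
  fixes v :: "complex \<times> complex \<Rightarrow> complex"
  assumes v: "continuous_on UNIV v" and fo: "finite_order_C2 (\<lambda>z. sin (v z))"
  obtains r0 K where "\<And>r. r \<ge> r0 \<Longrightarrow> (\<integral>x. \<bar>Im (v (r *\<^sub>R x))\<bar> \<partial>sphere_measure_C2) \<le> r ^ K"
proof -
  define T where "T = (\<lambda>r. nevanlinna_T r (\<lambda>z. sin (v z)))"
  have "Limsup at_top (\<lambda>r. ereal (log_plus (T r) / ln r)) \<noteq> \<infinity>"
    using fo unfolding finite_order_C2_def T_def by auto
  then obtain n :: nat where "Limsup at_top (\<lambda>r. ereal (log_plus (T r) / ln r)) < ereal (real n)"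
    unfolding less_PInf_Ex_of_nat by blast
  then have "\<forall>\<^sub>F r in at_top. ereal (log_plus (T r) / ln r) < ereal (real n)"
    by (rule Limsup_lessD)
  then obtain R where R: "\<And>r. r \<ge> R \<Longrightarrow> log_plus (T r) / ln r < real n"
    unfolding eventually_at_top_linorder by auto
  show thesis
  proof
    \<comment> \<open>The lower bound 2 makes \<open>ln r\<close> positive and gives
      \<open>4 \<le> r ^ 2\<close>, used at the end of the estimate.\<close>
    fix r assume r: "r \<ge> max R 2"
    have vr: "continuous_on UNIV (\<lambda>x. v (r *\<^sub>R x))"
      by (intro continuous_on_compose2[OF v] continuous_intros) auto
    have lnr: "ln r > 0" using r by simp
    have "T r \<le> max 1 (T r)" by simp
    also have "\<dots> = exp (log_plus (T r))" by (simp add: log_plus_def)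
    also have "\<dots> \<le> exp (real n * ln r)"
      using R[of r] r lnr by (simp add: divide_less_eq)
    also have "\<dots> = r ^ n" using r by (simp add: exp_of_nat_mult)
    finally have T: "T r \<le> r ^ n" .
    have "(\<integral>x. \<bar>Im (v (r *\<^sub>R x))\<bar> \<partial>sphere_measure_C2) \<le>
      (\<integral>x. ln 4 + log_plus (cmod (sin (v (r *\<^sub>R x)))) \<partial>sphere_measure_C2)"
      by (intro integral_mono integrable_sphere_measure_C2 continuous_intros vr abs_Im_le_log_plus_sin)
    also have "\<dots> = ln 4 + T r"
      unfolding T_def nevanlinna_T_def
      by (subst Bochner_Integration.integral_add)
         (auto intro!: integrable_sphere_measure_C2 continuous_intros vr
           simp: measure_def emeasure_sphere_measure_C2_UNIV)
    also have "\<dots> \<le> 3 + r ^ n"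
      using T ln_le_minus_one[of 4] by simp
    also have "\<dots> \<le> r ^ n * 4" using r one_le_power[of r n] by simp
    also have "\<dots> \<le> r ^ n * r ^ 2"
      using r power_mono[of 2 r 2] by (intro mult_left_mono) auto
    also have "\<dots> = r ^ (n + 2)" by (rule power_add[symmetric])
    finally show "(\<integral>x. \<bar>Im (v (r *\<^sub>R x))\<bar> \<partial>sphere_measure_C2) \<le> r ^ (n + 2)" .
  qed
qed

section \<open>From polynomial growth to the explicit form\<close>

text \<open>The shift \<open>D\<close> accommodates the fixed coordinate of a slice. Once
  \<open>cmod t \<ge> D\<close>, the base is at most \<open>2 * cmod t\<close>, and Liouville's
  theorem for polynomial growth applies.\<close>

lemma polynomial_of_growth:
  fixes g :: "complex \<Rightarrow> complex"
  assumes g: "g holomorphic_on UNIV" and bd: "\<And>t. cmod (g t) \<le> C * (D + cmod t) ^ K" and D: "D \<ge> 0"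
  obtains p where "\<And>t. g t = poly p t"
proof -
  have C: "C \<ge> 0"
  proof -
    have "0 \<le> C * (D + 1) ^ K" using order_trans[OF norm_ge_zero bd[of 1]] by simp
    moreover have "(D + 1) ^ K > 0" using D by simp
    ultimately show ?thesis by (simp add: zero_le_mult_iff)
  qed
  have "cmod (g t) \<le> (C * 2 ^ K) * cmod t ^ K" if "D \<le> cmod t" for t
  proof -
    have "C * (D + cmod t) ^ K \<le> C * (2 * cmod t) ^ K"
      using C D that by (intro mult_left_mono power_mono) auto
    with bd[of t] show ?thesis by (simp add: power_mult_distrib mult_ac)
  qed
  from Liouville_polynomial[OF g this]
  have "g t = (\<Sum>k\<le>K. (deriv ^^ k) g 0 / fact k * t ^ k)" for t .
  then have "g t = poly (\<Sum>k\<le>K. monom ((deriv ^^ k) g 0 / fact k) k) t" for t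
    by (simp add: poly_sum poly_monom)
  then show thesis by (rule that)
qed

lemma poly_const_pderiv:
  fixes p :: "complex poly"
  assumes "pderiv p = [:e:]"
  shows "poly p t = poly p 0 + e * t"
proof -
  have "pderiv (p - [:0, e:]) = 0"
    using assms by (simp add: pderiv_diff pderiv_pCons)
  then obtain a where "p - [:0, e:] = [:a:]"
    by (metis degree_eq_zeroE pderiv_eq_0_iff)
  then have "p = [:a:] + [:0, e:]" by (metis diff_add_cancel)
  then show ?thesis by simp
qed

lemma finite_order_solution_eq_sin:
  fixes c1 c2 :: complex and f :: "complex \<times> complex \<Rightarrow> complex"
  assumes tr: "transcendental_entire_C2 f"
    and fo: "finite_order_C2 f"
    and eq: "\<And>z1 z2. (partial_z1 f z1 z2)\<^sup>2 + (f (z1 + c1, z2 + c2))\<^sup>2 = 1"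
  obtains e q where "e\<^sup>2 = 1" "\<And>z1 z2. f (z1, z2) = sin (e * z1 + poly q z2)"
    "\<And>z. exp (\<i> * (e * c1 + poly q (z + c2) - poly q z)) = e"
proof -
  have ent: "entire_C2 f" and notpoly: "\<not> polynomial_C2 f"
    using tr by (auto simp: transcendental_entire_C2_def)
  obtain v where vcont: "continuous_on UNIV v" and fv: "\<And>z. f z = sin (v z)"
    and pv: "\<And>z1 z2. partial_z1 f z1 z2 = cos (v (z1 + c1, z2 + c2))"
    and vhol: "\<And>a b c d. (\<lambda>t. v (a + t * b, c + t * d)) holomorphic_on UNIV"
    by (rule obtain_arcsine[OF ent eq]) (rule that)
  have "f = (\<lambda>z. sin (v z))" using fv by auto
  with fo have "finite_order_C2 (\<lambda>z. sin (v z))" by simp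
  then obtain r0 K where mean: "\<And>r. r \<ge> r0 \<Longrightarrow> (\<integral>x. \<bar>Im (v (r *\<^sub>R x))\<bar> \<partial>sphere_measure_C2) \<le> r ^ K"
    using finite_order_C2_sin_mean[OF vcont] by metis
  have "(\<lambda>\<zeta>. v (cscale \<zeta> z)) holomorphic_on UNIV" for z
    using vhol[of 0 "fst z" 0 "snd z"] by (simp add: cscale_def)
  then obtain C where C: "\<And>z. cmod (v z) \<le> C * (1 + norm z) ^ K"
    using polynomial_growth_of_sphere_mean[OF vcont _ mean] by metis
  have C0: "C \<ge> 0" using order_trans[OF norm_ge_zero C[of 0]] by simp
  have Cpair: "cmod (v (a, b)) \<le> C * (1 + cmod a + cmod b) ^ K" for a b
  proof -
    have "(1 + norm (a, b)) ^ K \<le> (1 + cmod a + cmod b) ^ K"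
      using norm_Pair_le[of a b] by (intro power_mono) auto
    then show ?thesis using C[of "(a, b)"] C0 by (meson mult_left_mono order_trans)
  qed
  have "\<exists>p. \<forall>t. v (t, b) = poly p t" for b
    using polynomial_of_growth[of "\<lambda>t. v (t, b)" C "1 + cmod b" K] vhol[of 0 1 b 0] Cpair[of _ b]
    by (simp add: algebra_simps) metis
  then obtain \<phi> where \<phi>: "\<And>b t. v (t, b) = poly (\<phi> b) t" by metis
  obtain q where q: "\<And>b. v (0, b) = poly q b"
    using polynomial_of_growth[of "\<lambda>t. v (0, t)" C "1" K] vhol[of 0 0 0 1] Cpair[of 0]
    by auto
  have partial: "partial_z1 f t b = poly (pderiv (\<phi> b)) t * cos (poly (\<phi> b) t)" for t b
  proof -
    have "((\<lambda>w. f (w, b)) has_field_derivative poly (pderiv (\<phi> b)) t * cos (poly (\<phi> b) t)) (at t)"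
      unfolding fv \<phi> by (auto intro!: derivative_eq_intros)
    then show ?thesis unfolding partial_z1_def by (rule DERIV_imp_deriv)
  qed
  have "\<exists>e\<in>{0, 1, -1}. pderiv (\<phi> b) = [:e:]" for b
  \<comment> \<open>This \<open>\<psi>\<close> is \<open>v (t + c1, b + c2)\<close> as a polynomial
    in \<open>t\<close>.\<close>
  proof (rule pderiv_mult_cos_eq_cos[where \<psi> = "pcompose (\<phi> (b + c2)) [:c1, 1:]"])
    fix t
    show "poly (pderiv (\<phi> b)) t * cos (poly (\<phi> b) t) = cos (poly (pcompose (\<phi> (b + c2)) [:c1, 1:]) t)"
      using pv[of t b] unfolding partial \<phi> by (simp add: poly_pcompose add.commute)
  qed
  then obtain s where s: "\<And>b. s b \<in> {0, 1, -1}" "\<And>b. pderiv (\<phi> b) = [:s b:]" by metis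
  have v_eq: "v (t, b) = poly q b + s b * t" for t b
    using poly_const_pderiv[OF s(2), of b t] q[of b] by (simp add: \<phi>)
  \<comment> \<open>The slope \<open>s b\<close> equals \<open>v (1, b) - v (0, b)\<close>, so it is
    continuous in \<open>b\<close>, and it takes at most three values on a connected space.\<close>
  have "s constant_on UNIV"
  proof (rule continuous_finite_range_constant)
    have "s = (\<lambda>b. v (1, b) - v (0, b))" by (simp add: v_eq fun_eq_iff)
    moreover have "continuous_on UNIV (\<lambda>b. v (1, b) - v (0, b))"
      by (intro continuous_on_diff continuous_on_compose2[OF vcont] continuous_on_Pair
          continuous_on_const continuous_on_id) auto
    ultimately show "continuous_on UNIV s" by simp
    show "finite (range s)" by (rule finite_subset[of _ "{0, 1, -1}"]) (use s(1) in auto)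
  qed (rule connected_UNIV)
  then obtain e where e: "\<And>b. s b = e" by (auto simp: constant_on_def)
  have f_eq: "f (z1, z2) = sin (e * z1 + poly q z2)" for z1 z2
    by (simp add: fv v_eq e add.commute)
  \<comment> \<open>Slope 0 would make the derivative vanish, so that \<open>f\<close> takes only
    the values 1 and -1 and is constant by continuity, contradicting transcendence.\<close>
  have e0: "e \<noteq> 0"
  proof
    assume "e = 0"
    then have "(f z)\<^sup>2 = 1" for z
      using eq[of "fst z - c1" "snd z - c2"] partial s(2) e by simp
    then have fz: "f z = 1 \<or> f z = -1" for z by (simp add: power2_eq_1_iff)
    have "f constant_on UNIV"
    proof (rule continuous_finite_range_constant)
      show "continuous_on UNIV f" by (rule entire_C2_continuous[OF ent])
      show "finite (range f)" by (rule finite_subset[of _ "{1, -1}"]) (use fz in auto)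
    qed (rule connected_UNIV)
    then obtain k where "\<And>z. f z = k" by (auto simp: constant_on_def)
    then have "polynomial_C2 f"
      unfolding polynomial_C2_def by (intro exI[of _ 0] exI[of _ "\<lambda>_ _. k"]) simp
    with notpoly show False by simp
  qed
  have ee: "e\<^sup>2 = 1" using s(1)[of 0] e e0 by auto
  have "exp (\<i> * (e * c1 + poly q (z + c2) - poly q z)) = e" for z
  proof -
    define d where "d = e * c1 + poly q (z + c2) - poly q z"
    have "e * cos u = cos (u + d)" for u
    proof -
      \<comment> \<open>Solves \<open>poly q z + e * t = u\<close>, using \<open>e * e = 1\<close>;
        the equation at \<open>(t, z)\<close> then reads
        \<open>e * cos u = cos (u + d)\<close>.\<close>
      define t where "t = e * (u - poly q z)"
      have et: "e * t = u - poly q z"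
        using ee by (simp add: t_def power2_eq_square flip: mult.assoc)
      have "e * cos (poly q z + e * t) = cos (poly q (z + c2) + e * (t + c1))"
        using pv[of t z] partial[of t z] s(2) \<phi>[of t z] by (simp add: v_eq e)
      then show ?thesis by (simp add: distrib_left et d_def algebra_simps)
    qed
    \<comment> \<open>At \<open>u = 0\<close> the identity gives \<open>cos d = e\<close>, and at
      \<open>u = pi / 2\<close> it gives \<open>sin d = 0\<close>.\<close>
    from this[of 0] this[of "of_real (pi / 2)"]
    have "cos d = e" "sin d = 0"
      by (simp_all add: cos_add flip: cos_of_real sin_of_real)
    then show ?thesis unfolding d_def[symmetric] exp_Euler by simp
  qed
  with ee f_eq show thesis by (rule that)
qed

text \<open>Differentiating the constant exponential shows that its exponent has zero derivative, so
  \<open>pderiv q\<close> has period \<open>c\<close>. It then takes one value at all the points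
  \<open>n * c\<close>, infinitely many, and is constant.\<close>

lemma poly_eq_linear_of_exp_diff_const:
  fixes q :: "complex poly"
  assumes const: "\<And>z. exp (\<i> * (k + poly q (z + c) - poly q z)) = e" and c: "c \<noteq> 0"
  obtains a b where "q = [:a, b:]"
proof -
  define D where "D = [:k:] + pcompose q [:c, 1:] - q"
  have ex: "exp (\<i> * poly D z) = e" for z
    using const[of z] by (simp add: D_def poly_pcompose add.commute)
  have "poly (pderiv D) z = 0" for z
  proof -
    have "((\<lambda>z. exp (\<i> * poly D z)) has_field_derivative exp (\<i> * poly D z) * (\<i> * poly (pderiv D) z)) (at z)"
      by (auto intro!: derivative_eq_intros)
    then have "((\<lambda>_. e) has_field_derivative exp (\<i> * poly D z) * (\<i> * poly (pderiv D) z)) (at z)"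
      by (simp only: ex)
    then have "exp (\<i> * poly D z) * (\<i> * poly (pderiv D) z) = 0"
      using DERIV_unique DERIV_const by blast
    then show ?thesis by simp
  qed
  then have "poly (pderiv q) (c + z) = poly (pderiv q) z" for z
    by (simp add: D_def pderiv_diff pderiv_add pderiv_pcompose pderiv_pCons poly_pcompose)
  then have per: "poly (pderiv q) (z + c) = poly (pderiv q) z" for z
    by (simp only: add.commute[of z c])
  have "poly (pderiv q) (of_nat n * c) = poly (pderiv q) 0" for n
  proof (induction n)
    case (Suc n)
    then show ?case using per[of "of_nat n * c"] by (simp add: algebra_simps)
  qed simp
  then have sub: "range (\<lambda>n. of_nat n * c) \<subseteq> {z. poly (pderiv q - [:poly (pderiv q) 0:]) z = 0}"
    by auto
  have "inj (\<lambda>n. of_nat n * c :: complex)" using c by (auto simp: inj_on_def)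
  then have "infinite (range (\<lambda>n. of_nat n * c :: complex))" by (simp add: finite_image_iff)
  then have "pderiv q - [:poly (pderiv q) 0:] = 0"
    using sub poly_roots_finite finite_subset by blast
  then have "pderiv q = [:poly (pderiv q) 0:]" by simp
  from poly_const_pderiv[OF this] have "poly q z = poly [:poly q 0, poly (pderiv q) 0:] z" for z
    by (metis mult.commute poly_pCons poly_0 add.right_neutral mult_zero_right)
  then have "q = [:poly q 0, poly (pderiv q) 0:]" by (metis poly_eq_poly_eq_iff ext)
  then show thesis by (rule that)
qed

theorem theorem1p3:
  fixes c1 c2 :: complex and f :: "complex \<times> complex \<Rightarrow> complex"
  assumes "transcendental_entire_C2 f"
    and "finite_order_C2 f"
    and "\<And>z1 z2. (partial_z1 f z1 z2)\<^sup>2 + (f (z1 + c1, z2 + c2))\<^sup>2 = 1"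
  shows "\<exists>(A::complex) (B::complex) (\<alpha>::complex) (\<beta>1::complex) (\<beta>2::complex) (h::complex poly).
    \<alpha> \<noteq> 0 \<and> A\<^sup>2 = 1 \<and> \<beta>1 * \<beta>2 = 1 \<and>
    (\<forall>z1 z2. f (z1, z2) =
       A / (2 * \<i>) * (\<beta>1 * exp (\<alpha> * (\<i> / \<alpha> * A * z1 + B * z2 + poly h z2))
                     - \<beta>2 * exp (- \<alpha> * (\<i> / \<alpha> * A * z1 + B * z2 + poly h z2)))) \<and>
    (\<exists>logA. exp logA = A \<and>
       (\<forall>z2. poly h z2 - poly h (z2 + c2) = \<i> / \<alpha> * A * c1 + B * c2 + 1 / \<alpha> * logA)) \<and>
    A * exp (\<i> * A * c1 + \<alpha> * B * c2) = 1 \<and>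
    (c2 \<noteq> 0 \<longrightarrow>
       (\<exists>C::complex. h = [:C:] \<and>
          (\<forall>z1 z2. f (z1, z2) =
             A / (2 * \<i>) * (\<beta>1 * exp (\<alpha> * (\<i> / \<alpha> * A * z1 + B * z2 + C))
                           - \<beta>2 * exp (- \<alpha> * (\<i> / \<alpha> * A * z1 + B * z2 + C))))))"
proof -
  obtain e q where e: "e\<^sup>2 = 1" and f: "\<And>z1 z2. f (z1, z2) = sin (e * z1 + poly q z2)"
    and d: "\<And>z. exp (\<i> * (e * c1 + poly q (z + c2) - poly q z)) = e"
    using finite_order_solution_eq_sin[OF assms] by metis
  have ee: "e * e = 1" using e by (simp add: power2_eq_square)
  have inv: "inverse e = e" using ee by (metis inverse_unique)
  \<comment> \<open>Inserting \<open>e * e = 1\<close> gives the sine the required shape with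
    \<open>A\<close>, \<open>\<beta>1\<close> and \<open>\<beta>2\<close> all equal to
    \<open>e\<close>.\<close>
  have sin_eq: "sin w = e / (2 * \<i>) * (e * exp (\<i> * w) - e * exp (- (\<i> * w)))" for w
  proof -
    have "e / (2 * \<i>) * (e * exp (\<i> * w) - e * exp (- (\<i> * w)))
      = (e * e) * ((exp (\<i> * w) - exp (- (\<i> * w))) / (2 * \<i>))"
      by (simp only: right_diff_distrib[symmetric] times_divide_eq_left times_divide_eq_right mult.assoc)
    then show ?thesis by (simp only: ee sin_exp_eq) simp
  qed
  \<comment> \<open>If \<open>c2 = 0\<close>, all of \<open>\<i> * q\<close> goes into
    \<open>h\<close> and \<open>B = 0\<close>; otherwise \<open>q\<close> is affine, its slope gives
    \<open>B\<close> and its constant term gives \<open>h\<close>. Either way \<open>h\<close> has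
    period \<open>c2\<close>.\<close>
  obtain B h where h: "\<And>z. \<i> * poly q z = B * z + poly h z"
    and hc: "\<And>z. poly h (z + c2) = poly h z" and hC: "c2 \<noteq> 0 \<Longrightarrow> \<exists>C. h = [:C:]"
  proof (cases "c2 = 0")
    case True
    show thesis by (rule that[of 0 "smult \<i> q"]) (use True in auto)
  next
    case False
    obtain a b where "q = [:a, b:]"
      using poly_eq_linear_of_exp_diff_const[OF d False] by metis
    then show thesis by (intro that[of "\<i> * b" "[:\<i> * a:]"]) (auto simp: algebra_simps)
  qed
  have expk: "exp (\<i> * e * c1 + B * c2) = e"
  proof -
    have "\<i> * (e * c1 + poly q (0 + c2) - poly q 0) = \<i> * e * c1 + (\<i> * poly q (0 + c2) - \<i> * poly q 0)"
      by (simp add: algebra_simps)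
    also have "\<dots> = \<i> * e * c1 + B * c2"
      unfolding h hc by simp
    finally show ?thesis using d[of 0] by simp
  qed
  have F: "f (z1, z2) = e / (2 * \<i>) * (e * exp (1 * (\<i> / 1 * e * z1 + B * z2 + poly h z2))
                     - e * exp (- 1 * (\<i> / 1 * e * z1 + B * z2 + poly h z2)))" for z1 z2
  proof -
    have "\<i> * (e * z1 + poly q z2) = \<i> * e * z1 + B * z2 + poly h z2"
      unfolding distrib_left h by (simp add: mult.assoc add.assoc)
    then show ?thesis unfolding f sin_eq[of "e * z1 + poly q z2"] by simp
  qed
  \<comment> \<open>The logarithm of \<open>A\<close> is taken to be the negated exponent, which is
    admissible because \<open>inverse e = e\<close>; both sides of the relation for \<open>h\<close>
    are then 0.\<close>
  have L: "exp (- (\<i> * e * c1 + B * c2)) = e \<and>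
    (\<forall>z. poly h z - poly h (z + c2) = \<i> / 1 * e * c1 + B * c2 + 1 / 1 * (- (\<i> * e * c1 + B * c2)))"
    unfolding exp_minus expk inv hc by simp
  show ?thesis
  \<comment> \<open>Witnesses: \<open>\<alpha> = 1\<close> and
    \<open>A = \<beta>1 = \<beta>2 = e\<close>, so that
    \<open>\<beta>1 * \<beta>2 = e * e = 1\<close>.\<close>
  proof (rule exI[of _ e], rule exI[of _ B], rule exI[of _ 1], rule exI[of _ e], rule exI[of _ e],
      rule exI[of _ h], intro conjI)
    show "\<exists>logA. exp logA = e \<and> (\<forall>z2. poly h z2 - poly h (z2 + c2) = \<i> / 1 * e * c1 + B * c2 + 1 / 1 * logA)"
      using L by blast
    show "e * exp (\<i> * e * c1 + 1 * B * c2) = 1" using expk ee by simp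
    show "c2 \<noteq> 0 \<longrightarrow> (\<exists>C. h = [:C:] \<and> (\<forall>z1 z2. f (z1, z2) =
             e / (2 * \<i>) * (e * exp (1 * (\<i> / 1 * e * z1 + B * z2 + C))
                           - e * exp (- 1 * (\<i> / 1 * e * z1 + B * z2 + C)))))"
    proof
      assume "c2 \<noteq> 0"
      then obtain C where "h = [:C:]" using hC by auto
      then show "\<exists>C. h = [:C:] \<and> (\<forall>z1 z2. f (z1, z2) =
             e / (2 * \<i>) * (e * exp (1 * (\<i> / 1 * e * z1 + B * z2 + C))
                           - e * exp (- 1 * (\<i> / 1 * e * z1 + B * z2 + C))))"
        using F by auto
    qed
  qed (use e ee F in auto)
qed

end
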